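(* Let $\kappa$ be a regular uncountable cardinal and $S\subseteq\mathrm{acc}(\kappa)$. If $\mathrm P(\kappa,\kappa,\sqsubseteq^S,1)$ holds, then there exists a normal, prolific, streamlined $\kappa$-Souslin tree $T$ such that $V(T)\supseteq S$.
   Context: $\mathrm{acc}(\kappa)$: nonzero limit ordinals $<\kappa$. $H_\kappa$: sets of hereditary cardinality $<\kappa$. A streamlined $\kappa$-tree is a set $T\subseteq{}^{<\kappa}H_\kappa$ closed under restrictions with each $T_\alpha=T\cap{}^\alpha H_\kappa$ ($\alpha<\kappa$) nonempty of size $<\kappa$, viewed as the tree $(T,\subsetneq)$. Normal: for $\alpha<\beta<\kappa$, each node of level $\alpha$ has an extension in level $\beta$. Prolific: for all $\alpha<\kappa$ and $t\in T_\alpha$, $t^\frown\langle i\rangle\in T$ for every $i<\max\{\omega,\alpha\}$. $\kappa$-Souslin: no $\kappa$-branch and no antichain of size $\kappa$. An $\alpha$-branch: linearly ordered subset with set of heights $\alpha$; vanishing if no upper bound. $V(T)$: set of $\alpha\in\mathrm{acc}(\kappa)$ such that every node of height $<\alpha$ lies on a vanishing $\alpha$-branch. For a set of ordinals $C$: $\mathrm{acc}(C)=\{\alpha\in C\mid\sup(C\cap\alpha)=\alpha>0\}$, $\mathrm{nacc}(C)=C\setminus\mathrm{acc}(C)$. $D\sqsubseteq^S C$ iff $D=C\cap\beta$ for some ordinal $\beta$ and $\sup(D)\notin S$. $\mathrm P(\kappa,\kappa,\sqsubseteq^S,1)$ asserts that $\diamondsuit(\kappa)$ holds and there is a sequence $\langle\mathcal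 C_\alpha\mid\alpha<\kappa\rangle$ where each $\mathcal C_\alpha$ is a nonempty family of fewer than $\kappa$ closed subsets $C$ of $\alpha$ with $\sup(C)=\sup(\alpha)$, such that for all $\alpha<\kappa$, $C\in\mathcal C_\alpha$, $\bar\alpha\in\mathrm{acc}(C)$ there is $D\in\mathcal C_{\bar\alpha}$ with $D\sqsubseteq^S C$, and for every cofinal $B\subseteq\kappa$ there are stationarily many $\alpha<\kappa$ with $\sup(\mathrm{nacc}(C)\cap B)=\alpha$ for all $C\in\mathcal C_\alpha$. *)

theory Defs
  imports Main
begin

unbundle cardinal_syntax

section \<open>The cardinal \<open>\<kappa>\<close> and its ordinals\<close>

text \<open>
  The ordinals below \<open>\<kappa>\<close> are the elements of a type \<open>'k\<close> of class \<^class>\<open>wellorder\<close>; an ordinal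
  \<open>\<alpha> < \<kappa>\<close>, seen as the set of its predecessors, is \<open>{..<\<alpha>}\<close>, and \<open>\<kappa>\<close> itself is \<open>UNIV\<close>,
  ordered by \<open>kappa\<close> below.
\<close>

definition kappa :: "'k::wellorder rel" where
  "kappa = {(\<alpha>, \<beta>). \<alpha> \<le> \<beta>}"

definition regular_uncountable_cardinal :: "'a rel \<Rightarrow> bool" where
  "regular_uncountable_cardinal r \<longleftrightarrow> Card_order r \<and> natLeq <o r \<and> regularCard r"

definition ozero :: "'k::wellorder" where
  "ozero = (LEAST \<alpha>. True)"

definition acc_kappa :: "'k::wellorder set" where
  "acc_kappa = {\<alpha>. \<alpha> \<noteq> ozero \<and> (\<forall>\<beta><\<alpha>. \<exists>\<gamma><\<alpha>. \<beta> < \<gamma>)}"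

definition omega :: "'k::wellorder" where
  "omega = (LEAST \<alpha>. \<alpha> \<in> acc_kappa)"

text \<open>Supremum of a set of ordinals that is bounded in \<open>\<kappa>\<close>, with \<open>sup \<emptyset> = 0\<close>. It is only ever
  applied to bounded sets.\<close>

definition osup :: "'k::wellorder set \<Rightarrow> 'k" where
  "osup A = (LEAST \<beta>. \<forall>\<alpha>\<in>A. \<alpha> \<le> \<beta>)"

definition acc :: "'k::wellorder set \<Rightarrow> 'k set" where
  "acc C = {\<alpha> \<in> C. osup (C \<inter> {..<\<alpha>}) = \<alpha> \<and> ozero < \<alpha>}"

definition nacc :: "'k::wellorder set \<Rightarrow> 'k set" where
  "nacc C = C - acc C"

definition cofinal_kappa :: "'k::wellorder set \<Rightarrow> bool" where
  "cofinal_kappa B \<longleftrightarrow> (\<forall>\<alpha>. \<exists>\<beta>\<in>B. \<alpha> \<le> \<beta>)"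

definition club :: "'k::wellorder set \<Rightarrow> bool" where
  "club E \<longleftrightarrow> cofinal_kappa E \<and>
     (\<forall>\<alpha>. ozero < \<alpha> \<and> osup (E \<inter> {..<\<alpha>}) = \<alpha> \<longrightarrow> \<alpha> \<in> E)"

definition stationary :: "'k::wellorder set \<Rightarrow> bool" where
  "stationary A \<longleftrightarrow> (\<forall>E. club E \<longrightarrow> A \<inter> E \<noteq> {})"

definition closed_subset_of :: "'k::wellorder set \<Rightarrow> 'k \<Rightarrow> bool" where
  "closed_subset_of C \<alpha> \<longleftrightarrow> C \<subseteq> {..<\<alpha>} \<and>
     (\<forall>\<beta><\<alpha>. ozero < \<beta> \<and> osup (C \<inter> {..<\<beta>}) = \<beta> \<longrightarrow> \<beta> \<in> C)"


section \<open>Diamond and the proxy principle\<close>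

definition diamond :: "'k::wellorder itself \<Rightarrow> bool" where
  "diamond _ \<longleftrightarrow> (\<exists>A :: 'k \<Rightarrow> 'k set. (\<forall>\<alpha>. A \<alpha> \<subseteq> {..<\<alpha>}) \<and>
     (\<forall>X. stationary {\<alpha>. X \<inter> {..<\<alpha>} = A \<alpha>}))"

text \<open>\<open>sq_end S D C\<close> is \<open>D \<sqsubseteq>\<^sup>S C\<close>. It is only applied to \<open>C\<close> bounded in \<open>\<kappa>\<close>, so that letting
  \<open>\<beta>\<close> range over the ordinals below \<open>\<kappa>\<close> loses nothing.\<close>

definition sq_end :: "'k::wellorder set \<Rightarrow> 'k set \<Rightarrow> 'k set \<Rightarrow> bool" where
  "sq_end S D C \<longleftrightarrow> (\<exists>\<beta>. D = C \<inter> {..<\<beta>}) \<and> osup D \<notin> S"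

text \<open>\<open>proxy S\<close> is \<open>P(\<kappa>,\<kappa>,\<sqsubseteq>\<^sup>S,1)\<close>.\<close>

definition proxy :: "'k::wellorder set \<Rightarrow> bool" where
  "proxy S \<longleftrightarrow> diamond TYPE('k) \<and>
     (\<exists>\<C> :: 'k \<Rightarrow> 'k set set.
        (\<forall>\<alpha>. \<C> \<alpha> \<noteq> {} \<and> |\<C> \<alpha>| <o |UNIV :: 'k set| \<and>
             (\<forall>C\<in>\<C> \<alpha>. closed_subset_of C \<alpha> \<and> osup C = osup {..<\<alpha>})) \<and>
        (\<forall>\<alpha>. \<forall>C\<in>\<C> \<alpha>. \<forall>\<alpha>'\<in>acc C. \<exists>D\<in>\<C> \<alpha>'. sq_end S D C) \<and>
        (\<forall>B. cofinal_kappa B \<longrightarrow>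
             stationary {\<alpha>. \<forall>C\<in>\<C> \<alpha>. osup (nacc C \<inter> B) = \<alpha>}))"


section \<open>Sets of hereditary cardinality below \<open>\<kappa>\<close>\<close>

text \<open>
  HOL has no type of all sets, so we build the well-founded sets that hereditarily have at most
  \<open>|'k|\<close> elements: well-founded trees branching over \<open>'k\<close>, where \<open>Node f\<close> denotes the set
  of the denotations of the trees in the range of \<open>f\<close>, modulo having the same elements.
  The lemmas below show that the result is well-founded, extensional, and
  closed under forming sets of at most \<open>|'k|\<close> elements. In particular it contains every set whose
  transitive closure has cardinality below \<open>\<kappa>\<close>.
\<close>

datatype (dead 'k) tree = Node "'k \<Rightarrow> 'k tree option"

primrec children :: "'k tree \<Rightarrow> 'k tree set" where
  "children (Node f) = ran f"

inductive same_set :: "'k tree \<Rightarrow> 'k tree \<Rightarrow> bool" where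
  "\<lbrakk>\<forall>x\<in>children s. \<exists>y\<in>children t. same_set x y; \<forall>y\<in>children t. \<exists>x\<in>children s. same_set x y\<rbrakk>
   \<Longrightarrow> same_set s t"

lemma tree_children_induct:
  assumes "\<And>t. (\<And>x. x \<in> children t \<Longrightarrow> P x) \<Longrightarrow> P t"
  shows "P t"
proof (induction t)
  case (Node f)
  show ?case
  proof (rule assms)
    fix x assume "x \<in> children (Node f)"
    then obtain i where i: "f i = Some x" by (auto simp: ran_def)
    show "P x" using Node[of "f i" x] i by (metis option.set_intros rangeI)
  qed
qed

lemma same_set_refl: "same_set t t"
  by (induction t rule: tree_children_induct) (blast intro: same_set.intros)

lemma same_set_sym: "same_set s t \<Longrightarrow> same_set t s"
  by (induction rule: same_set.induct) (rule same_set.intros; blast)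

lemma same_set_trans: "same_set s t \<Longrightarrow> same_set t u \<Longrightarrow> same_set s u"
proof (induction s arbitrary: t u rule: tree_children_induct)
  case (1 s)
  from 1(2) have st: "\<forall>x\<in>children s. \<exists>y\<in>children t. same_set x y"
    "\<forall>y\<in>children t. \<exists>x\<in>children s. same_set x y" by (auto elim: same_set.cases)
  from 1(3) have tu: "\<forall>x\<in>children t. \<exists>y\<in>children u. same_set x y"
    "\<forall>y\<in>children u. \<exists>x\<in>children t. same_set x y" by (auto elim: same_set.cases)
  show ?case
    by (rule same_set.intros) (meson st tu 1(1))+
qed

quotient_type 'k hset = "'k tree" / same_set
  by (rule equivpI) (auto intro!: reflpI sympI transpI
      intro: same_set_refl same_set_sym same_set_trans)

lift_definition hmem :: "'k hset \<Rightarrow> 'k hset \<Rightarrow> bool" is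
  "\<lambda>s t. \<exists>x\<in>children t. same_set s x"
proof -
  fix s s' t t' :: "'k tree"
  assume a: "same_set s s'" "same_set t t'"
  from a(2) have tt: "\<forall>x\<in>children t. \<exists>y\<in>children t'. same_set x y"
    "\<forall>y\<in>children t'. \<exists>x\<in>children t. same_set x y" by (auto elim: same_set.cases)
  show "(\<exists>x\<in>children t. same_set s x) = (\<exists>x\<in>children t'. same_set s' x)"
    using a(1) tt by (meson same_set_sym same_set_trans)
qed

definition elts :: "'k hset \<Rightarrow> 'k hset set" where
  "elts x = {y. hmem y x}"

lemma elts_abs: "elts (abs_hset t) = abs_hset ` children t"
proof -
  have "hmem y (abs_hset t) \<longleftrightarrow> (\<exists>x\<in>children t. y = abs_hset x)" for y
  proof (induction y rule: hset.abs_induct)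
    case (1 s)
    show ?case by (simp add: hmem.abs_eq hset.abs_eq_iff)
  qed
  then show ?thesis by (auto simp: elts_def)
qed

lemma elts_inject: "elts x = elts y \<longleftrightarrow> x = y"
proof
  assume eq: "elts x = elts y"
  have surj: "\<exists>s. z = abs_hset s" for z
    by (induction z rule: hset.abs_induct) blast
  obtain s t where st: "x = abs_hset s" "y = abs_hset t"
    using surj by blast
  from eq have im: "abs_hset ` children s = abs_hset ` children t"
    by (simp add: st elts_abs)
  have "same_set s t"
  proof (rule same_set.intros; intro ballI)
    fix a assume "a \<in> children s"
    then have "abs_hset a \<in> abs_hset ` children t" using im by blast
    then show "\<exists>b\<in>children t. same_set a b" by (auto simp: hset.abs_eq_iff)
  next
    fix b assume "b \<in> children t"
    then have "abs_hset b \<in> abs_hset ` children s" using im by blast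
    then show "\<exists>a\<in>children s. same_set a b"
      by (auto simp: hset.abs_eq_iff) (blast intro: same_set_sym)
  qed
  then show "x = y" by (simp add: st hset.abs_eq_iff)
qed simp

lemma hset_induct:
  assumes "\<And>x. (\<And>y. y \<in> elts x \<Longrightarrow> P y) \<Longrightarrow> P x"
  shows "P x"
proof -
  have "P (abs_hset t)" for t
    by (induction t rule: tree_children_induct) (rule assms, auto simp: elts_abs)
  then show ?thesis by (rule hset.abs_induct)
qed

lemma wf_elts: "wf {(y, x). y \<in> elts x}"
  unfolding wf_def by (intro allI impI, rule hset_induct) auto

lemma ex_hset:
  fixes A :: "'k hset set"
  assumes "|A| \<le>o |UNIV :: 'k set|"
  shows "\<exists>x. elts x = A"
proof -
  obtain g :: "'k hset \<Rightarrow> 'k" where g: "inj_on g A"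
    using assms by (auto simp: card_of_ordLeq[symmetric])
  define f where
    "f i = (if i \<in> g ` A then Some (rep_hset (inv_into A g i)) else None)" for i
  have "ran f = rep_hset ` A"
    unfolding ran_def f_def using inv_into_f_f[OF g] by (auto simp: image_iff) metis+
  then have "elts (abs_hset (Node f)) = A"
    by (simp add: elts_abs image_image Quotient3_abs_rep[OF Quotient3_hset])
  then show ?thesis by blast
qed

text \<open>The set with the given elements, provided there are at most \<open>|'k|\<close> of them.\<close>

definition HSet :: "'k hset set \<Rightarrow> 'k hset" where
  "HSet A = (THE x. elts x = A)"

lemma elts_HSet:
  fixes A :: "'k hset set"
  assumes "|A| \<le>o |UNIV :: 'k set|"
  shows "elts (HSet A) = A"
proof -
  obtain x where x: "elts x = A" using ex_hset[OF assms] by blast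
  then have "HSet A = x" unfolding HSet_def
    by (intro the_equality) (simp_all add: elts_inject flip: x)
  with x show ?thesis by simp
qed

definition trcl :: "'k hset \<Rightarrow> 'k hset set" where
  "trcl x = {y. (y, x) \<in> {(a, b). a \<in> elts b}\<^sup>+}"

definition H_kappa :: "'k::wellorder hset set" where
  "H_kappa = {x. |trcl x| <o |UNIV :: 'k set|}"

text \<open>The von Neumann ordinals below \<open>\<kappa>\<close>.\<close>

function vN :: "'k::wellorder \<Rightarrow> 'k hset" where
  "vN \<alpha> = HSet (vN ` {..<\<alpha>})"
  by auto
termination by (relation "{(\<alpha>, \<beta>). \<alpha> < \<beta>}") (auto simp: wf)

declare vN.simps [simp del]

lemma elts_vN: "elts (vN \<alpha>) = vN ` {..<\<alpha>}"
proof -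
  have "|vN ` {..<\<alpha>}| \<le>o |UNIV :: 'a set|"
    by (meson card_of_image card_of_mono1 ordLeq_transitive subset_UNIV)
  then show ?thesis by (subst vN.simps) (rule elts_HSet)
qed

lemma trcl_vN: "trcl (vN \<alpha>) = vN ` {..<\<alpha>}"
proof
  have "(y, x) \<in> {(a, b). a \<in> elts b}\<^sup>+ \<Longrightarrow> x = vN \<alpha> \<Longrightarrow> y \<in> vN ` {..<\<alpha>}" for x y
    by (induction rule: converse_trancl_induct) (force simp: elts_vN)+
  then show "trcl (vN \<alpha>) \<subseteq> vN ` {..<\<alpha>}" by (auto simp: trcl_def)
  show "vN ` {..<\<alpha>} \<subseteq> trcl (vN \<alpha>)" by (auto simp: trcl_def elts_vN)
qed

lemma inj_vN: "inj vN"
proof -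
  have False if "\<alpha> < \<beta>" "vN \<alpha> = vN \<beta>" for \<alpha> \<beta> :: 'a
  proof -
    have "vN \<alpha> \<in> elts (vN \<alpha>)" using that by (metis elts_vN imageI lessThan_iff)
    then show False using wf_not_sym[OF wf_elts, of "vN \<alpha>" "vN \<alpha>"] by simp
  qed
  then show ?thesis by (metis injI linorder_neqE)
qed

lemma vN_in_H_kappa:
  assumes "Card_order (kappa :: 'k::wellorder rel)"
  shows "vN (\<alpha> :: 'k) \<in> H_kappa"
proof -
  have F: "Field (kappa :: 'k rel) = UNIV" by (auto simp: kappa_def Field_def)
  have "underS (kappa :: 'k rel) \<alpha> = {..<\<alpha>}" by (auto simp: kappa_def underS_def)
  then have "|{..<\<alpha>}| <o (kappa :: 'k rel)"
    using card_of_underS[OF assms(1), of \<alpha>] F by simp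
  moreover have "|UNIV :: 'k set| =o (kappa :: 'k rel)"
    using card_of_Field_ordIso[OF assms(1)] F by simp
  ultimately have "|{..<\<alpha>}| <o |UNIV :: 'k set|"
    by (meson ordIso_symmetric ordLess_ordIso_trans)
  then show ?thesis
    unfolding H_kappa_def mem_Collect_eq trcl_vN
    by (rule ordLeq_ordLess_trans[OF card_of_image])
qed


section \<open>Streamlined trees\<close>

text \<open>
  A function with domain \<open>\<alpha> < \<kappa>\<close> is a partial map \<open>t\<close> with \<open>dom t = {..<\<alpha>}\<close>; inclusion of
  functions is \<open>\<subseteq>\<^sub>m\<close>.
\<close>

type_synonym 'k node = "'k \<rightharpoonup> 'k hset"

definition seqs :: "'k::wellorder \<Rightarrow> 'k node set" where
  "seqs \<alpha> = {t. dom t = {..<\<alpha>} \<and> ran t \<subseteq> H_kappa}"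

definition level :: "'k::wellorder node set \<Rightarrow> 'k \<Rightarrow> 'k node set" where
  "level T \<alpha> = T \<inter> seqs \<alpha>"

definition streamlined_tree :: "'k::wellorder node set \<Rightarrow> bool" where
  "streamlined_tree T \<longleftrightarrow> T \<subseteq> (\<Union>\<alpha>. seqs \<alpha>) \<and>
     (\<forall>t\<in>T. \<forall>\<beta>. t |` {..<\<beta>} \<in> T) \<and>
     (\<forall>\<alpha>. level T \<alpha> \<noteq> {} \<and> |level T \<alpha>| <o |UNIV :: 'k set| )"

definition normal_tree :: "'k::wellorder node set \<Rightarrow> bool" where
  "normal_tree T \<longleftrightarrow> (\<forall>\<alpha> \<beta>. \<alpha> < \<beta> \<longrightarrow> (\<forall>t\<in>level T \<alpha>. \<exists>s\<in>level T \<beta>. t \<subseteq>\<^sub>m s))"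

definition prolific :: "'k::wellorder node set \<Rightarrow> bool" where
  "prolific T \<longleftrightarrow> (\<forall>\<alpha>. \<forall>t\<in>level T \<alpha>. \<forall>i<max omega \<alpha>. t(\<alpha> \<mapsto> vN i) \<in> T)"

definition proper_ext :: "'k node \<Rightarrow> 'k node \<Rightarrow> bool" where
  "proper_ext s t \<longleftrightarrow> s \<subseteq>\<^sub>m t \<and> s \<noteq> t"

text \<open>The height of a node is the order type of the set of its predecessors; in a tree closed under
  restrictions it is the domain of the node.\<close>

definition ht :: "'k::wellorder node set \<Rightarrow> 'k node \<Rightarrow> 'k" where
  "ht T t = (THE \<alpha>. \<exists>f. bij_betw f {..<\<alpha>} {s \<in> T. proper_ext s t} \<and>
     (\<forall>\<beta><\<alpha>. \<forall>\<gamma><\<alpha>. \<beta> < \<gamma> \<longleftrightarrow> proper_ext (f \<beta>) (f \<gamma>)))"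

text \<open>\<open>branch T A B\<close>: \<open>B\<close> is a linearly ordered subset of \<open>T\<close> with set of heights \<open>A\<close>. So
  \<open>A = {..<\<alpha>}\<close> gives the \<open>\<alpha>\<close>-branches, for \<open>\<alpha> < \<kappa>\<close>, and \<open>A = UNIV\<close> the \<open>\<kappa>\<close>-branches.\<close>

definition branch :: "'k::wellorder node set \<Rightarrow> 'k set \<Rightarrow> 'k node set \<Rightarrow> bool" where
  "branch T A B \<longleftrightarrow> B \<subseteq> T \<and> (\<forall>s\<in>B. \<forall>t\<in>B. s \<subseteq>\<^sub>m t \<or> t \<subseteq>\<^sub>m s) \<and> ht T ` B = A"

definition vanishing :: "'k::wellorder node set \<Rightarrow> 'k node set \<Rightarrow> bool" where
  "vanishing T B \<longleftrightarrow> \<not> (\<exists>t\<in>T. \<forall>s\<in>B. s \<subseteq>\<^sub>m t)"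

definition antichain :: "'k::wellorder node set \<Rightarrow> 'k node set \<Rightarrow> bool" where
  "antichain T A \<longleftrightarrow> A \<subseteq> T \<and> (\<forall>s\<in>A. \<forall>t\<in>A. s \<noteq> t \<longrightarrow> \<not> s \<subseteq>\<^sub>m t \<and> \<not> t \<subseteq>\<^sub>m s)"

definition souslin :: "'k::wellorder node set \<Rightarrow> bool" where
  "souslin T \<longleftrightarrow> \<not> (\<exists>B. branch T UNIV B) \<and>
     \<not> (\<exists>A. antichain T A \<and> |A| =o |UNIV :: 'k set| )"

definition vanishing_levels :: "'k::wellorder node set \<Rightarrow> 'k set" where
  "vanishing_levels T = {\<alpha> \<in> acc_kappa. \<forall>x\<in>T. ht T x < \<alpha> \<longrightarrow>
     (\<exists>B. branch T {..<\<alpha>} B \<and> vanishing T B \<and> x \<in> B)}"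

lemma lessThan_iso_le:
  fixes \<alpha> \<beta> :: "'k::wellorder"
  assumes h: "\<And>\<gamma>. \<gamma> < \<alpha> \<Longrightarrow> h \<gamma> < \<beta>" "\<And>\<gamma> \<delta>. \<gamma> < \<delta> \<Longrightarrow> \<delta> < \<alpha> \<Longrightarrow> h \<gamma> < h \<delta>"
  shows "\<alpha> \<le> \<beta>"
proof (rule ccontr)
  assume "\<not> \<alpha> \<le> \<beta>"
  then have "\<beta> < \<alpha>" by simp
  have "\<gamma> < \<alpha> \<Longrightarrow> \<gamma> \<le> h \<gamma>" for \<gamma>
  proof (induction \<gamma> rule: less_induct)
    case (less \<gamma>)
    show ?case
    proof (rule ccontr)
      assume n: "\<not> \<gamma> \<le> h \<gamma>"
      then have "h \<gamma> < \<alpha>" using less by simp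
      with n less have "h \<gamma> \<le> h (h \<gamma>)" "h (h \<gamma>) < h \<gamma>" using h(2) by auto
      then show False by simp
    qed
  qed
  with \<open>\<beta> < \<alpha>\<close> h(1) show False by (meson leD)
qed

lemma ht_eq:
  fixes T :: "'k::wellorder node set"
  assumes T: "\<forall>t\<in>T. \<forall>\<beta>. t |` {..<\<beta>} \<in> T" "T \<subseteq> (\<Union>\<alpha>. seqs \<alpha>)"
    and t: "t \<in> T" "dom t = {..<\<alpha>}"
  shows "ht T t = \<alpha>"
proof -
  let ?P = "{s \<in> T. proper_ext s t}"
  let ?Q = "\<lambda>(\<alpha>::'k) f. bij_betw f {..<\<alpha>} ?P \<and>
     (\<forall>\<beta><\<alpha>. \<forall>\<gamma><\<alpha>. \<beta> < \<gamma> \<longleftrightarrow> proper_ext (f \<beta>) (f \<gamma>))"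
  let ?f = "\<lambda>\<beta>. t |` {..<\<beta>}"
  have dom_f: "dom (?f \<beta>) = {..<\<beta>}" if "\<beta> \<le> \<alpha>" for \<beta>
    using that t(2) by auto
  have mono: "proper_ext (?f \<beta>) (?f \<gamma>)" if "\<beta> < \<gamma>" "\<gamma> \<le> \<alpha>" for \<beta> \<gamma>
  proof -
    have "?f \<beta> \<subseteq>\<^sub>m ?f \<gamma>" using that by (auto simp: map_le_def restrict_map_def)
    moreover have "dom (?f \<beta>) \<noteq> dom (?f \<gamma>)" using that dom_f by auto
    then have "?f \<beta> \<noteq> ?f \<gamma>" by metis
    ultimately show ?thesis by (simp add: proper_ext_def)
  qed
  have f_alpha: "?f \<alpha> = t"
  proof
    fix x
    have "x < \<alpha> \<longleftrightarrow> t x \<noteq> None" using t(2) by (metis domIff lessThan_iff)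
    then show "?f \<alpha> x = t x" by (auto simp: restrict_map_def)
  qed
  have asym: "\<not> proper_ext a b" if "proper_ext b a" for a b :: "'k node"
    using that by (auto simp: proper_ext_def intro: map_le_antisym)
  have iff: "\<beta> < \<gamma> \<longleftrightarrow> proper_ext (?f \<beta>) (?f \<gamma>)" if "\<beta> < \<alpha>" "\<gamma> < \<alpha>" for \<beta> \<gamma>
    using mono[of \<beta> \<gamma>] mono[of \<gamma> \<beta>] asym that
    by (metis less_imp_le linorder_neqE proper_ext_def)
  have inj: "inj_on ?f {..<\<alpha>}"
    by (rule inj_onI) (metis iff lessThan_iff linorder_neqE proper_ext_def)
  have im: "?f ` {..<\<alpha>} = ?P"
  proof
    show "?f ` {..<\<alpha>} \<subseteq> ?P" using T t mono[of _ \<alpha>] f_alpha by auto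
    show "?P \<subseteq> ?f ` {..<\<alpha>}"
    proof
      fix s assume s: "s \<in> ?P"
      then obtain \<beta> where b: "dom s = {..<\<beta>}" using T(2) by (auto simp: seqs_def)
      have le: "s \<subseteq>\<^sub>m t" "s \<noteq> t" using s by (auto simp: proper_ext_def)
      have eq: "s = ?f \<beta>"
      proof
        fix x show "s x = ?f \<beta> x"
          using le(1) b by (cases "x < \<beta>") (auto simp: map_le_def restrict_map_def)
      qed
      have "{..<\<beta>} \<subseteq> {..<\<alpha>}" using le(1) b t(2) map_le_implies_dom_le by metis
      then have "\<beta> \<le> \<alpha>" by (meson lessThan_iff less_irrefl not_le subsetD)
      moreover have "\<beta> \<noteq> \<alpha>" using le(2) eq f_alpha by auto
      ultimately show "s \<in> ?f ` {..<\<alpha>}" using eq by auto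
    qed
  qed
  have ex: "?Q \<alpha> ?f" using inj im iff by (auto simp: bij_betw_def)
  have le: "\<gamma> \<le> \<delta>" if g: "?Q \<gamma> g" and k: "?Q \<delta> k" for \<gamma> \<delta> :: 'k and g k
  proof (rule lessThan_iso_le[where h = "\<lambda>x. inv_into {..<\<delta>} k (g x)"])
    have gP: "g x \<in> k ` {..<\<delta>}" if "x < \<gamma>" for x
    proof -
      have "g ` {..<\<gamma>} = k ` {..<\<delta>}"
        using g k bij_betw_imp_surj_on[of g] bij_betw_imp_surj_on[of k] by metis
      then show ?thesis using that by blast
    qed
    show h1: "inv_into {..<\<delta>} k (g x) < \<delta>" if "x < \<gamma>" for x
      using inv_into_into[OF gP[OF that]] by simp
    show "inv_into {..<\<delta>} k (g x) < inv_into {..<\<delta>} k (g y)" if "x < y" "y < \<gamma>" for x y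
    proof -
      have "x < \<gamma>" using that by simp
      have "proper_ext (g x) (g y)" using g that \<open>x < \<gamma>\<close> by blast
      then have "proper_ext (k (inv_into {..<\<delta>} k (g x))) (k (inv_into {..<\<delta>} k (g y)))"
        by (simp only: f_inv_into_f[OF gP[OF \<open>x < \<gamma>\<close>]] f_inv_into_f[OF gP[OF \<open>y < \<gamma>\<close>]])
      then show ?thesis using k h1[OF \<open>x < \<gamma>\<close>] h1[OF \<open>y < \<gamma>\<close>] by blast
    qed
  qed
  show ?thesis
    unfolding ht_def
  proof (rule the_equality)
    show "\<exists>f. ?Q \<alpha> f" using ex by blast
    fix \<beta> assume "\<exists>f. ?Q \<beta> f"
    then obtain f where "?Q \<beta> f" by blast
    then show "\<beta> = \<alpha>" using le[OF _ ex] le[OF ex] by (metis (lifting) order.antisym)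
  qed
qed

end

theory Submission
  imports Defs
begin

text \<open>
  The tree is built level by level. At a limit \<open>\<alpha>\<close>, the nodes are the limits of branches that
  climb along some club \<open>C \<in> \<C>\<^sub>\<alpha>\<close>: from the level \<open>d \<in> C\<close> to the next element \<open>e\<close> of \<open>C\<close> such a
  branch first appends a fixed bit \<open>i\<close>, and then takes a canonical extension to level \<open>e\<close> that enters
  the set guessed by diamond at \<open>e\<close>, if possible. Coherence of the clubs lets these branches pass
  through the limit points of \<open>C\<close>, and the hitting clause of the proxy principle makes some level lie
  entirely above any given dense set, which excludes large antichains and cofinal branches.

  The relation \<open>\<sqsubseteq>\<^sup>S\<close> ensures that no point of \<open>S\<close> is a limit point of any of the clubs. Hence for
  \<open>\<alpha> \<in> S\<close> one may shrink \<open>\<C>\<^sub>\<alpha>\<close> to a single club \<open>C\<close> and admit at level \<open>\<alpha>\<close> only the branches with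
  bit \<open>0\<close>. The branches along \<open>C\<close> with bit \<open>1\<close> then have no upper bound, as they differ from the
  others at a tail of \<open>C\<close>.
\<close>

section \<open>Ordinals below a regular uncountable cardinal\<close>

lemma osup_le: "(\<And>a. a \<in> X \<Longrightarrow> a \<le> b) \<Longrightarrow> osup X \<le> b"
  unfolding osup_def by (rule Least_le) blast

lemma osup_upper: "(\<And>a. a \<in> X \<Longrightarrow> a \<le> b) \<Longrightarrow> a \<in> X \<Longrightarrow> a \<le> osup X"
  unfolding osup_def using LeastI[of "\<lambda>\<beta>. \<forall>\<alpha>\<in>X. \<alpha> \<le> \<beta>" b] by blast

text \<open>Translates the supremum conditions of the principle, stated with \<open>LEAST\<close>,
  into unboundedness below \<open>a\<close>.\<close>

lemma osup_eq_iff: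
  fixes X :: "'k::wellorder set"
  assumes "X \<subseteq> {..<a}"
  shows "osup X = a \<longleftrightarrow> (\<forall>b<a. \<exists>x\<in>X. b < x)"
proof
  assume eq: "osup X = a"
  show "\<forall>b<a. \<exists>x\<in>X. b < x"
  proof (intro allI impI, rule ccontr)
    fix b assume "b < a" "\<not> (\<exists>x\<in>X. b < x)"
    then have "osup X \<le> b" by (intro osup_le) (auto simp: not_less)
    with eq \<open>b < a\<close> show False by simp
  qed
next
  assume un: "\<forall>b<a. \<exists>x\<in>X. b < x"
  have le: "osup X \<le> a" using assms by (intro osup_le) (auto intro: less_imp_le)
  show "osup X = a"
  proof (rule ccontr)
    assume "osup X \<noteq> a"
    with le have "osup X < a" by simp
    with un obtain x where "x \<in> X" "osup X < x" by blast
    moreover have "x \<le> osup X"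
      using assms \<open>x \<in> X\<close> by (intro osup_upper[of X a]) (auto intro: less_imp_le)
    ultimately show False by simp
  qed
qed

lemma ozero_le [simp]: "ozero \<le> \<alpha>"
  unfolding ozero_def by (rule Least_le) simp

lemma acc_iff: "\<alpha> \<in> acc C \<longleftrightarrow> \<alpha> \<in> C \<and> ozero < \<alpha> \<and> (\<forall>\<beta><\<alpha>. \<exists>x\<in>C. \<beta> < x \<and> x < \<alpha>)"
  using osup_eq_iff[of "C \<inter> {..<\<alpha>}" \<alpha>] by (auto simp: acc_def)

lemma acc_kappa_iff: "\<alpha> \<in> acc_kappa \<longleftrightarrow> ozero < \<alpha> \<and> (\<forall>\<beta><\<alpha>. \<exists>\<gamma><\<alpha>. \<beta> < \<gamma>)"
  using ozero_le[of \<alpha>] by (auto simp: acc_kappa_def simp del: ozero_le)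

definition consecutive :: "'k::wellorder set \<Rightarrow> 'k \<Rightarrow> 'k \<Rightarrow> bool" where
  "consecutive C d e \<longleftrightarrow> d \<in> C \<and> e \<in> C \<and> d < e \<and> (\<forall>x\<in>C. \<not> (d < x \<and> x < e))"

text \<open>The predecessor of \<open>e\<close> in \<open>C\<close> is the supremum of
  \<open>C\<close> below \<open>e\<close>. It is smaller than \<open>e\<close> because
  \<open>e\<close> is not a limit point, and closedness puts it into \<open>C\<close>. The element
  \<open>g\<close> rules out the default value \<open>ozero\<close> of an empty supremum.\<close>

lemma consecutive_below:
  assumes C: "closed_subset_of C \<alpha>" and "g \<in> C" "e \<in> C" "g < e" "e \<notin> acc C"
  obtains d where "consecutive C d e" "g \<le> d"
proof -
  have "ozero < e" using ozero_le \<open>g < e\<close> by (rule le_less_trans)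
  with assms obtain b where b: "b < e" "\<And>x. x \<in> C \<Longrightarrow> x < e \<Longrightarrow> x \<le> b"
    by (force simp: acc_iff not_less)
  define m where "m = osup (C \<inter> {..<e})"
  have up: "x \<le> m" if "x \<in> C" "x < e" for x
    unfolding m_def using that b by (intro osup_upper[of _ b]) auto
  have "m \<le> b" unfolding m_def using b by (intro osup_le) auto
  then have "m < e" using b by simp
  have "m \<in> C"
  proof (rule ccontr)
    assume "m \<notin> C"
    then have "C \<inter> {..<e} = C \<inter> {..<m}" using up \<open>m < e\<close> by (auto simp: less_le)
    then have "osup (C \<inter> {..<m}) = m" by (simp add: m_def)
    moreover have "g < m" using up[of g] \<open>g \<in> C\<close> \<open>g < e\<close> \<open>m \<notin> C\<close> by (auto simp: less_le)
    then have "ozero < m" using ozero_le le_less_trans by blast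
    moreover have "m < \<alpha>" using C \<open>e \<in> C\<close> \<open>m < e\<close> by (auto simp: closed_subset_of_def)
    ultimately show False using C \<open>m \<notin> C\<close> by (auto simp: closed_subset_of_def)
  qed
  show thesis
  proof
    show "consecutive C m e"
      using \<open>m \<in> C\<close> \<open>e \<in> C\<close> \<open>m < e\<close> up by (fastforce simp: consecutive_def)
    show "g \<le> m" using up \<open>g \<in> C\<close> \<open>g < e\<close> by blast
  qed
qed

lemma consecutive_above:
  assumes "d \<in> C" "x \<in> C" "d < x"
  obtains e where "consecutive C d e"
proof
  let ?P = "\<lambda>e. e \<in> C \<and> d < e"
  have "?P (LEAST e. ?P e)" using assms by (intro LeastI[of ?P x]) simp
  then show "consecutive C d (LEAST e. ?P e)"
    using assms not_less_Least[of _ ?P] by (auto simp: consecutive_def)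
qed

definition osucc :: "'k::wellorder \<Rightarrow> 'k" where
  "osucc \<alpha> = (LEAST \<beta>. \<alpha> < \<beta>)"

lemma osucc_le: "\<alpha> < \<beta> \<Longrightarrow> osucc \<alpha> \<le> \<beta>"
  unfolding osucc_def by (rule Least_le)

lemma ordinal_cases:
  obtains "\<alpha> = ozero" | "\<alpha> \<in> acc_kappa" | \<beta> where "\<alpha> = osucc \<beta>" "\<beta> < \<alpha>"
proof (cases "\<alpha> = ozero \<or> \<alpha> \<in> acc_kappa")
  case False
  then obtain \<beta> where "\<beta> < \<alpha>" "\<And>\<gamma>. \<gamma> < \<alpha> \<Longrightarrow> \<not> \<beta> < \<gamma>" by (auto simp: acc_kappa_def)
  then have "osucc \<beta> = \<alpha>" unfolding osucc_def by (intro Least_equality) (auto simp: not_less[symmetric])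
  with \<open>\<beta> < \<alpha>\<close> that show thesis by metis
qed (use that in blast)

section \<open>Small sets, successors and closure points under regularity of \<kappa>\<close>

locale regular_kappa =
  fixes K :: "'k::wellorder itself"
  assumes regular: "regular_uncountable_cardinal (kappa :: 'k rel)"
begin

lemma Field_kappa: "Field (kappa :: 'k rel) = UNIV"
  by (auto simp: kappa_def Field_def)

lemma Card_order_kappa: "Card_order (kappa :: 'k rel)"
  using regular by (simp add: regular_uncountable_cardinal_def)

lemma card_UNIV: "|UNIV :: 'k set| =o (kappa :: 'k rel)"
  using card_of_Field_ordIso[OF Card_order_kappa] Field_kappa by simp

lemma less_card_iff: "|A| <o |UNIV :: 'k set| \<longleftrightarrow> |A| <o (kappa :: 'k rel)"
  using card_UNIV by (meson ordIso_symmetric ordLess_ordIso_trans)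

lemma natLeq_kappa: "natLeq <o (kappa :: 'k rel)"
  using regular by (simp add: regular_uncountable_cardinal_def)

lemma cinfinite_kappa: "cinfinite (kappa :: 'k rel)"
  using natLeq_kappa Card_order_kappa
  by (meson cinfinite_mono natLeq_cinfinite ordLess_imp_ordLeq)

lemma infinite_UNIV: "\<not> finite (UNIV :: 'k set)"
  using cinfinite_kappa Field_kappa by (simp add: cinfinite_def)

lemma small_lessThan: "|{..<\<alpha>}| <o |UNIV :: 'k set|" for \<alpha> :: 'k
proof -
  have "underS (kappa :: 'k rel) \<alpha> = {..<\<alpha>}" by (auto simp: kappa_def underS_def)
  then show ?thesis
    using card_of_underS[OF Card_order_kappa, of \<alpha>] Field_kappa by (simp add: less_card_iff)
qed

lemma small_finite: "finite A \<Longrightarrow> |A| <o |UNIV :: 'k set|"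
  using infinite_UNIV by (intro finite_ordLess_infinite) (simp_all add: card_of_well_order_on Field_card_of)

lemma small_range_nat: "|range (f :: nat \<Rightarrow> 'b)| <o |UNIV :: 'k set|"
proof -
  have "|range f| \<le>o natLeq" using card_of_image card_of_nat by (rule ordLeq_ordIso_trans)
  then show ?thesis using natLeq_kappa by (simp add: less_card_iff ordLeq_ordLess_trans)
qed

lemma small_mono: "A \<subseteq> B \<Longrightarrow> |B| <o |UNIV :: 'k set| \<Longrightarrow> |A| <o |UNIV :: 'k set|"
  using card_of_mono1 ordLeq_ordLess_trans by blast

lemma small_image: "|B| <o |UNIV :: 'k set| \<Longrightarrow> |f ` B| <o |UNIV :: 'k set|"
  using card_of_image ordLeq_ordLess_trans by blast

lemma small_UN:
  assumes "|I| <o |UNIV :: 'k set|" "\<And>i. i \<in> I \<Longrightarrow> |A i| <o |UNIV :: 'k set|"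
  shows "|\<Union>i\<in>I. A i| <o |UNIV :: 'k set|"
  unfolding less_card_iff
  by (rule regularCard_UNION_bound)
    (use assms regular cinfinite_kappa in \<open>auto simp: less_card_iff regular_uncountable_cardinal_def\<close>)

lemma ex_greater: "\<exists>\<beta>. \<alpha> < \<beta>" for \<alpha> :: 'k
  using infinite_Card_order_limit[OF Card_order_kappa, of \<alpha>] infinite_UNIV
  by (simp add: Field_kappa) (auto simp: kappa_def less_le)

lemma less_osucc [simp]: "\<alpha> < osucc \<alpha>" for \<alpha> :: 'k
  unfolding osucc_def using ex_greater by (rule LeastI_ex)

lemma osucc_inject: "osucc \<alpha> = osucc \<beta> \<longleftrightarrow> \<alpha> = \<beta>" for \<alpha> \<beta> :: 'k
  by (metis less_osucc linorder_neqE not_le osucc_le)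

lemma less_osucc_iff: "\<alpha> < osucc \<beta> \<longleftrightarrow> \<alpha> \<le> \<beta>" for \<alpha> \<beta> :: 'k
  by (meson le_less_trans less_osucc not_le osucc_le)

text \<open>Regularity makes every cofinal set as large as \<kappa>, so a small set is not cofinal;
  a further element above its bound makes the inequality strict.\<close>

lemma small_bounded:
  fixes A :: "'k set"
  assumes "|A| <o |UNIV :: 'k set|"
  shows "\<exists>\<beta>. \<forall>a\<in>A. a < \<beta>"
proof -
  have "\<not> cofinal A (kappa :: 'k rel)"
    using assms regular not_ordLess_ordIso[of "|A|" "kappa :: 'k rel"]
    by (auto simp: regular_uncountable_cardinal_def regularCard_def Field_kappa less_card_iff)
  then obtain a where "\<forall>b\<in>A. b \<le> a" by (force simp: cofinal_def Field_kappa kappa_def)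
  then show ?thesis by (meson ex_greater le_less_trans)
qed

text \<open>Let \<open>g\<close> dominate \<open>f\<close> on initial segments. The supremum of the
  iterates of \<open>g\<close> is closed under \<open>f\<close>; it exists below \<kappa> because
  \<kappa> is regular and uncountable.\<close>

lemma club_closure_points:
  fixes f :: "'k \<Rightarrow> 'k"
  shows "club {\<beta>. ozero < \<beta> \<and> (\<forall>\<gamma><\<beta>. f \<gamma> < \<beta>)}"
  unfolding club_def
proof
  show "cofinal_kappa {\<beta>. ozero < \<beta> \<and> (\<forall>\<gamma><\<beta>. f \<gamma> < \<beta>)}"
    unfolding cofinal_kappa_def
  proof
    fix \<alpha> :: 'k
    have "\<exists>\<beta>>\<gamma>. \<forall>\<delta><\<gamma>. f \<delta> < \<beta>" for \<gamma>
      using small_bounded[OF small_image[OF small_lessThan], of f \<gamma>]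
      by (metis ex_greater imageI lessThan_iff less_trans not_less_iff_gr_or_eq)
    then obtain g where g: "\<And>\<gamma>. \<gamma> < g \<gamma>" "\<And>\<gamma> \<delta>. \<delta> < \<gamma> \<Longrightarrow> f \<delta> < g \<gamma>" by metis
    define h where "h n = (g ^^ n) (osucc \<alpha>)" for n
    have h: "h (Suc n) = g (h n)" for n by (simp add: h_def)
    obtain b where b: "\<And>n. h n < b" using small_bounded[OF small_range_nat, of h] by blast
    define \<beta> where "\<beta> = osup (range h)"
    have le: "h n \<le> \<beta>" for n
      unfolding \<beta>_def using b by (intro osup_upper[of _ b]) (auto intro: less_imp_le)
    have lt: "h n < \<beta>" for n using le[of "Suc n"] g(1)[of "h n"] h by (metis less_le_trans)
    have "\<alpha> < \<beta>" using less_trans[OF less_osucc lt[of 0, unfolded h_def funpow_0]] .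
    moreover have "f \<gamma> < \<beta>" if \<gamma>: "\<gamma> < \<beta>" for \<gamma>
    proof -
      have "\<exists>x\<in>range h. \<gamma> < x"
        using osup_eq_iff[of "range h" \<beta>] lt \<gamma> by (auto simp: \<beta>_def)
      then obtain n where "\<gamma> < h n" by blast
      then show ?thesis using g(2) h lt by (metis less_trans)
    qed
    ultimately show "\<exists>\<beta>\<in>{\<beta>. ozero < \<beta> \<and> (\<forall>\<gamma><\<beta>. f \<gamma> < \<beta>)}. \<alpha> \<le> \<beta>"
      using le_less_trans[OF ozero_le \<open>\<alpha> < \<beta>\<close>] by (intro bexI[of _ \<beta>]) auto
  qed
  show "\<forall>\<alpha>. ozero < \<alpha> \<and> osup ({\<beta>. ozero < \<beta> \<and> (\<forall>\<gamma><\<beta>. f \<gamma> < \<beta>)} \<inter> {..<\<alpha>}) = \<alpha> \<longrightarrow>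
      \<alpha> \<in> {\<beta>. ozero < \<beta> \<and> (\<forall>\<gamma><\<beta>. f \<gamma> < \<beta>)}"
  proof (intro allI impI, elim conjE)
    fix \<alpha> :: 'k
    let ?E = "{\<beta>. ozero < \<beta> \<and> (\<forall>\<gamma><\<beta>. f \<gamma> < \<beta>)}"
    assume "ozero < \<alpha>" and "osup (?E \<inter> {..<\<alpha>}) = \<alpha>"
    then have "\<forall>b<\<alpha>. \<exists>x\<in>?E \<inter> {..<\<alpha>}. b < x"
      using osup_eq_iff[of "?E \<inter> {..<\<alpha>}" \<alpha>] by blast
    then show "\<alpha> \<in> ?E" using \<open>ozero < \<alpha>\<close> by (auto intro: less_trans)
  qed
qed

text \<open>The form in which both diamond and the hitting clause are applied: a single function
  \<open>f\<close> encodes all the closure that is wanted of the chosen point.\<close>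

lemma stationary_closure_point:
  fixes f :: "'k \<Rightarrow> 'k"
  assumes "stationary Z"
  obtains \<beta> where "\<beta> \<in> Z" "ozero < \<beta>" "\<And>\<gamma>. \<gamma> < \<beta> \<Longrightarrow> f \<gamma> < \<beta>"
  using assms club_closure_points[of f] by (auto simp: stationary_def)

lemma closure_point_limit:
  assumes "ozero < \<beta>" "\<And>\<gamma>. \<gamma> < \<beta> \<Longrightarrow> osucc \<gamma> < \<beta>"
  shows "(\<beta> :: 'k) \<in> acc_kappa"
  unfolding acc_kappa_iff using assms less_osucc by blast

text \<open>The \<open>LEAST\<close> defining \<open>omega\<close> is meaningful once some limit
  exists below \<kappa>; closure points of the successor function are limits.\<close>

lemma omega_limit: "(omega :: 'k) \<in> acc_kappa"
proof -
  obtain \<beta> :: 'k where "ozero < \<beta>" "\<forall>\<gamma><\<beta>. osucc \<gamma> < \<beta>"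
    using club_closure_points[of osucc] by (auto simp: club_def cofinal_kappa_def)
  then have "\<exists>\<alpha> :: 'k. \<alpha> \<in> acc_kappa" using closure_point_limit by blast
  then show ?thesis unfolding omega_def by (rule LeastI_ex)
qed

lemma osucc_less_limit: "\<alpha> \<in> acc_kappa \<Longrightarrow> \<beta> < \<alpha> \<Longrightarrow> osucc \<beta> < \<alpha>" for \<alpha> \<beta> :: 'k
  unfolding acc_kappa_iff using osucc_le le_less_trans by blast

lemma zero_one_less_omega: "i \<in> {ozero, osucc ozero} \<Longrightarrow> i < (omega :: 'k)"
  using omega_limit osucc_less_limit[OF omega_limit] by (auto simp: acc_kappa_iff)

end

section \<open>Construction of the levels\<close>

lemma map_le_restrict_eq: "s \<subseteq>\<^sub>m t \<Longrightarrow> dom s = X \<Longrightarrow> t |` X = s"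
  by (rule ext) (auto simp: map_le_def restrict_map_def)

lemma restrict_map_le: "t |` X \<subseteq>\<^sub>m t"
  by (auto simp: map_le_def)

lemma restrict_le_restrict: "\<beta> \<le> \<alpha> \<Longrightarrow> (t |` {..<\<alpha>}) |` {..<\<beta>} = t |` {..<\<beta>}"
  for \<alpha> \<beta> :: "'k::wellorder"
  by (rule ext) (auto simp: restrict_map_def)

lemma restrict_dom: "dom t = X \<Longrightarrow> t |` X = t"
  by (rule ext) (auto simp: restrict_map_def)

text \<open>The proxy principle in the form that the recursion uses: the coherence witness at a
  limit point of \<open>C\<close> is literally an initial segment of \<open>C\<close>, and the
  families at points of \<open>S\<close> are already thinned out. The injection \<open>p\<close>
  turns pairs of a level and an index into ordinals, so that \<open>A\<close> can guess sets of
  nodes.\<close>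

locale tree_construction = regular_kappa K
  for K :: "'k::wellorder itself" +
  fixes S :: "'k set" and A :: "'k \<Rightarrow> 'k set" and CC :: "'k \<Rightarrow> 'k set set" and p :: "'k \<times> 'k \<Rightarrow> 'k"
  assumes S_limit: "S \<subseteq> acc_kappa"
    and CC_nonempty: "CC \<alpha> \<noteq> {}"
    and CC_small: "|CC \<alpha>| <o |UNIV :: 'k set|"
    and CC_closed: "C \<in> CC \<alpha> \<Longrightarrow> closed_subset_of C \<alpha>"
    and CC_unbounded: "C \<in> CC \<alpha> \<Longrightarrow> \<alpha> \<in> acc_kappa \<Longrightarrow> \<beta> < \<alpha> \<Longrightarrow> \<exists>c\<in>C. \<beta> < c"
    and CC_coherent: "C \<in> CC \<alpha> \<Longrightarrow> \<beta> \<in> acc C \<Longrightarrow> C \<inter> {..<\<beta>} \<in> CC \<beta> \<and> \<beta> \<notin> S"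
    and CC_unique: "\<alpha> \<in> S \<Longrightarrow> C \<in> CC \<alpha> \<Longrightarrow> D \<in> CC \<alpha> \<Longrightarrow> C = D"
    and CC_hits: "cofinal_kappa B \<Longrightarrow> stationary {\<alpha>. \<forall>C\<in>CC \<alpha>. osup (nacc C \<inter> B) = \<alpha>}"
    and guess: "stationary {\<alpha>. X \<inter> {..<\<alpha>} = A \<alpha>}"
    and inj_p: "inj p"
begin

text \<open>Within the recursion a node of level \<open>\<gamma>\<close> can only be coded by reference to the levels already
  built; hence the injection chosen for each level separately.\<close>

definition code :: "('k \<Rightarrow> 'k node set) \<Rightarrow> 'k \<Rightarrow> 'k node \<Rightarrow> 'k" where
  "code L \<gamma> t = p (\<gamma>, (SOME g. inj_on g (L \<gamma>)) t)"

text \<open>When \<open>A e\<close> consists of codes of members of a set \<open>Y\<close> of nodes,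
  this says for \<open>s\<close> in level \<open>e\<close> that a proper initial segment of
  \<open>s\<close> lies in \<open>Y\<close>.\<close>

definition meets :: "('k \<Rightarrow> 'k node set) \<Rightarrow> 'k \<Rightarrow> 'k node \<Rightarrow> bool" where
  "meets L e s \<longleftrightarrow> (\<exists>\<gamma><e. code L \<gamma> (s |` {..<\<gamma>}) \<in> A e)"

text \<open>The choice refers neither to the club nor to the limit level under construction. Hence a
  branch along \<open>C\<close> is built by the same steps as one along an initial segment of
  \<open>C\<close>, which is how coherence of the clubs is exploited.\<close>

definition step :: "('k \<Rightarrow> 'k node set) \<Rightarrow> 'k \<Rightarrow> 'k node \<Rightarrow> 'k \<Rightarrow> 'k \<Rightarrow> 'k node" where
  "step L i t d e =
     (if \<exists>s. s \<in> L e \<and> t(d \<mapsto> vN i) \<subseteq>\<^sub>m s \<and> meets L e s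
      then SOME s. s \<in> L e \<and> t(d \<mapsto> vN i) \<subseteq>\<^sub>m s \<and> meets L e s
      else SOME s. s \<in> L e \<and> t(d \<mapsto> vN i) \<subseteq>\<^sub>m s)"

text \<open>Since only those \<open>e\<close> with \<open>{..<e} \<subseteq> dom t\<close> are considered, the notion applies to the initial
  segments of a branch along \<open>C\<close> as well.\<close>

definition coherent :: "('k \<Rightarrow> 'k node set) \<Rightarrow> 'k \<Rightarrow> 'k set \<Rightarrow> 'k \<Rightarrow> 'k node \<Rightarrow> bool" where
  "coherent L i C \<gamma> t \<longleftrightarrow> (\<forall>e\<in>C. \<gamma> \<le> e \<and> {..<e} \<subseteq> dom t \<longrightarrow>
     t |` {..<e} \<in> L e \<and>
     (\<forall>d. consecutive C d e \<and> \<gamma> \<le> d \<longrightarrow> t |` {..<e} = step L i (t |` {..<d}) d e))"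

definition indices :: "'k \<Rightarrow> 'k set" where
  "indices \<alpha> = (if \<alpha> \<in> S then {ozero} else {ozero, osucc ozero})"

text \<open>Allowing every start \<gamma> makes all lower nodes extendible. From \<gamma> on, a
  branch is determined by its part below \<gamma>, the club and the bit, which keeps the level
  small.\<close>

definition limit_level :: "('k \<Rightarrow> 'k node set) \<Rightarrow> 'k \<Rightarrow> 'k node set" where
  "limit_level L \<alpha> =
     {t. dom t = {..<\<alpha>} \<and> (\<exists>C\<in>CC \<alpha>. \<exists>i\<in>indices \<alpha>. \<exists>\<gamma>\<in>C. coherent L i C \<gamma> t)}"

definition next_level :: "('k \<Rightarrow> 'k node set) \<Rightarrow> 'k \<Rightarrow> 'k node set" where
  "next_level L \<alpha> =
     (if \<alpha> = ozero then {Map.empty}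
      else if \<alpha> \<in> acc_kappa then limit_level L \<alpha>
      else {t(\<beta> \<mapsto> vN i) |t \<beta> i. \<alpha> = osucc \<beta> \<and> t \<in> L \<beta> \<and> i < max omega \<beta>})"

function Lev :: "'k \<Rightarrow> 'k node set" where
  "Lev \<alpha> = next_level (\<lambda>\<beta>. if \<beta> < \<alpha> then Lev \<beta> else {}) \<alpha>"
  by auto
termination by (relation "{(\<alpha>, \<beta>). \<alpha> < \<beta>}") (auto simp: wf)

declare Lev.simps [simp del]

section \<open>Unfolding the recursion\<close>

lemma step_cong:
  assumes "\<And>\<beta>. \<beta> \<le> e \<Longrightarrow> L \<beta> = M \<beta>"
  shows "step L i t d e = step M i t d e"
proof -
  have "meets L e s = meets M e s" for s
    using assms by (auto simp: meets_def code_def)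
  then show ?thesis unfolding step_def using assms[of e] by (simp only: order_refl)
qed

lemma coherent_cong:
  assumes "\<And>\<beta>. \<beta> < \<alpha> \<Longrightarrow> L \<beta> = M \<beta>" "C \<subseteq> {..<\<alpha>}"
  shows "coherent L i C \<gamma> t = coherent M i C \<gamma> t"
proof -
  have "step L i t d e = step M i t d e" "L e = M e" if "e \<in> C" for t d e
    using assms that by (auto intro!: step_cong intro: le_less_trans)
  then show ?thesis unfolding coherent_def by (auto simp: consecutive_def)
qed

lemma Lev_zero: "Lev ozero = {Map.empty}"
  by (simp add: Lev.simps[of ozero] next_level_def)

lemma CC_subset: "C \<in> CC \<alpha> \<Longrightarrow> C \<subseteq> {..<\<alpha>}"
  using CC_closed by (auto simp: closed_subset_of_def)

lemma Lev_limit: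
  assumes "\<alpha> \<in> acc_kappa"
  shows "Lev \<alpha> = limit_level Lev \<alpha>"
proof -
  have "coherent (\<lambda>\<beta>. if \<beta> < \<alpha> then Lev \<beta> else {}) i C \<gamma> t = coherent Lev i C \<gamma> t"
    if "C \<in> CC \<alpha>" for C i \<gamma> t
    using CC_subset[OF that] by (intro coherent_cong[of \<alpha>]) auto
  then have "limit_level (\<lambda>\<beta>. if \<beta> < \<alpha> then Lev \<beta> else {}) \<alpha> = limit_level Lev \<alpha>"
    unfolding limit_level_def by simp
  with assms show ?thesis
    by (simp add: Lev.simps[of \<alpha>] next_level_def acc_kappa_def)
qed

lemma osucc_not_limit: "osucc \<beta> \<notin> acc_kappa" "osucc \<beta> \<noteq> ozero" for \<beta> :: 'k
proof -
  show "osucc \<beta> \<notin> acc_kappa" using osucc_less_limit[of "osucc \<beta>" \<beta>] by auto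
  show "osucc \<beta> \<noteq> ozero" using less_osucc[of \<beta>] ozero_le[of \<beta>] by (metis not_le)
qed

lemma Lev_succ: "Lev (osucc \<beta>) = {t(\<beta> \<mapsto> vN i) |t i. t \<in> Lev \<beta> \<and> i < max omega \<beta>}"
  by (subst Lev.simps) (force simp: next_level_def osucc_not_limit osucc_inject)

lemma Lev_succI: "t \<in> Lev \<beta> \<Longrightarrow> i \<in> {ozero, osucc ozero} \<Longrightarrow> t(\<beta> \<mapsto> vN i) \<in> Lev (osucc \<beta>)"
  using zero_one_less_omega[of i] by (force simp: Lev_succ less_max_iff_disj)

section \<open>Levels: domains, restrictions, determinacy and size\<close>

lemma Lev_dom: "t \<in> Lev \<alpha> \<Longrightarrow> dom t = {..<\<alpha>}"
proof (induction \<alpha> arbitrary: t rule: less_induct)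
  case (less \<alpha>)
  show ?case
  proof (cases \<alpha> rule: ordinal_cases)
    case 1
    moreover have "\<not> x < ozero" for x :: 'k using ozero_le[of x] by (simp add: not_less)
    ultimately show ?thesis using less by (auto simp: Lev_zero)
  next
    case 2
    then show ?thesis using less by (auto simp: Lev_limit limit_level_def)
  next
    case (3 \<beta>)
    have *: "{..<osucc \<beta>} = insert \<beta> {..<\<beta>}" by (auto simp: less_osucc_iff)
    obtain s i where "t = s(\<beta> \<mapsto> vN i)" "s \<in> Lev \<beta>" using less.prems 3 by (auto simp: Lev_succ)
    moreover from this have "dom t = insert \<beta> (dom s)" by (auto split: if_splits)
    ultimately have "dom t = insert \<beta> {..<\<beta>}" using less.IH[of \<beta> s] 3 by metis
    then show ?thesis using 3 * by simp
  qed
qed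

lemma Lev_limit_elim:
  assumes "t \<in> Lev \<alpha>" "\<alpha> \<in> acc_kappa"
  obtains C i \<gamma> where "C \<in> CC \<alpha>" "i \<in> indices \<alpha>" "\<gamma> \<in> C" "coherent Lev i C \<gamma> t"
  using assms by (auto simp: Lev_limit limit_level_def)

lemma coherent_restrict_Lev:
  assumes "coherent Lev i C \<gamma> t" "e \<in> C" "\<gamma> \<le> e" "{..<e} \<subseteq> dom t"
  shows "t |` {..<e} \<in> Lev e"
  using assms by (auto simp: coherent_def)

lemma coherent_step:
  assumes "coherent Lev i C \<gamma> t" "consecutive C d e" "\<gamma> \<le> d" "{..<e} \<subseteq> dom t"
  shows "t |` {..<e} = step Lev i (t |` {..<d}) d e"
proof -
  have "e \<in> C" "\<gamma> \<le> e" using assms by (auto simp: consecutive_def)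
  with assms show ?thesis by (auto simp: coherent_def)
qed

text \<open>Reduces claims about a limit node to initial segments of it that are nodes of lower
  levels, where an induction hypothesis applies.\<close>

lemma coherent_cofinal_Lev:
  assumes "coherent Lev i C \<gamma> t" "C \<in> CC \<alpha>" "\<alpha> \<in> acc_kappa" "\<gamma> \<in> C" "dom t = {..<\<alpha>}" "\<beta> < \<alpha>"
  obtains e where "e \<in> C" "\<beta> < e" "\<gamma> < e" "e < \<alpha>" "t |` {..<e} \<in> Lev e"
proof -
  have "max \<beta> \<gamma> < \<alpha>" using assms CC_subset by auto
  then obtain e where e: "e \<in> C" "max \<beta> \<gamma> < e" using CC_unbounded assms by meson
  moreover have "e < \<alpha>" using e CC_subset assms by auto
  ultimately show thesis using that assms coherent_restrict_Lev by auto
qed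

lemma Lev_ran: "t \<in> Lev \<alpha> \<Longrightarrow> ran t \<subseteq> range vN"
proof (induction \<alpha> arbitrary: t rule: less_induct)
  case (less \<alpha>)
  show ?case
  proof (cases \<alpha> rule: ordinal_cases)
    case 1
    then show ?thesis using less by (auto simp: Lev_zero)
  next
    case 2
    then obtain C i \<gamma> where C: "C \<in> CC \<alpha>" "i \<in> indices \<alpha>" "\<gamma> \<in> C" "coherent Lev i C \<gamma> t"
      using less by (blast elim: Lev_limit_elim)
    show ?thesis
    proof
      fix v assume "v \<in> ran t"
      then obtain \<xi> where \<xi>: "t \<xi> = Some v" by (auto simp: ran_def)
      then have "\<xi> < \<alpha>" using Lev_dom[OF less.prems] by auto
      then obtain e where e: "\<xi> < e" "e < \<alpha>" "t |` {..<e} \<in> Lev e"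
        using coherent_cofinal_Lev C 2 Lev_dom[OF less.prems] by metis
      have "(t |` {..<e}) \<xi> = Some v" using \<xi> e by simp
      then show "v \<in> range vN" using less.IH[OF e(2,3)] by (blast intro: ranI)
    qed
  next
    case (3 \<beta>)
    then obtain s i where s: "t = s(\<beta> \<mapsto> vN i)" "s \<in> Lev \<beta>" using less by (auto simp: Lev_succ)
    then have "ran t \<subseteq> insert (vN i) (ran s)" by (auto simp: ran_def)
    then show ?thesis using less.IH[OF 3(2) s(2)] by auto
  qed
qed

lemma Lev_seqs: "Lev \<alpha> \<subseteq> seqs \<alpha>"
  using Lev_dom Lev_ran vN_in_H_kappa[OF Card_order_kappa] by (fastforce simp: seqs_def)

lemma Lev_restrict: "t \<in> Lev \<alpha> \<Longrightarrow> \<beta> \<le> \<alpha> \<Longrightarrow> t |` {..<\<beta>} \<in> Lev \<beta>"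
proof (induction \<alpha> arbitrary: t rule: less_induct)
  case (less \<alpha>)
  show ?case
  proof (cases "\<beta> = \<alpha>")
    case True
    then show ?thesis using less Lev_dom restrict_dom by metis
  next
    case False
    then have "\<beta> < \<alpha>" using less by simp
    show ?thesis
    proof (cases \<alpha> rule: ordinal_cases)
      case 1
      then show ?thesis using \<open>\<beta> < \<alpha>\<close> ozero_le[of \<beta>] by (simp add: not_le[symmetric])
    next
      case 2
      then obtain C i \<gamma> where C: "C \<in> CC \<alpha>" "i \<in> indices \<alpha>" "\<gamma> \<in> C" "coherent Lev i C \<gamma> t"
        using less by (blast elim: Lev_limit_elim)
      then obtain e where e: "\<beta> < e" "e < \<alpha>" "t |` {..<e} \<in> Lev e"
        using coherent_cofinal_Lev 2 Lev_dom[OF less.prems(1)] \<open>\<beta> < \<alpha>\<close> by metis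
      then have "(t |` {..<e}) |` {..<\<beta>} \<in> Lev \<beta>" using less.IH[of e] less_imp_le by blast
      then show ?thesis using restrict_le_restrict[of \<beta> e t] e by simp
    next
      case (3 \<delta>)
      then obtain s i where s: "t = s(\<delta> \<mapsto> vN i)" "s \<in> Lev \<delta>" using less by (auto simp: Lev_succ)
      have "\<beta> \<le> \<delta>" using 3 \<open>\<beta> < \<alpha>\<close> by (simp add: less_osucc_iff)
      then have "t |` {..<\<beta>} = s |` {..<\<beta>}" using s(1) by (intro ext) (auto simp: restrict_map_def)
      then show ?thesis using less.IH[OF 3(2) s(2) \<open>\<beta> \<le> \<delta>\<close>] by simp
    qed
  qed
qed

text \<open>Induction along \<open>C\<close>: at a limit point of \<open>C\<close> the values are
  collected from below, and at any other point above \<gamma> the function \<open>step\<close>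
  computes the restriction from the one at the predecessor.\<close>

lemma coherent_unique:
  assumes C: "closed_subset_of C \<alpha>" "\<gamma> \<in> C"
    and co: "coherent Lev i C \<gamma> t" "coherent Lev i C \<gamma> t'"
    and eq: "t |` {..<\<gamma>} = t' |` {..<\<gamma>}"
  shows "e \<in> C \<Longrightarrow> \<gamma> \<le> e \<Longrightarrow> {..<e} \<subseteq> dom t \<Longrightarrow> {..<e} \<subseteq> dom t' \<Longrightarrow> t |` {..<e} = t' |` {..<e}"
proof (induction e rule: less_induct)
  case (less e)
  have sub: "{..<d} \<subseteq> dom t" "{..<d} \<subseteq> dom t'" if "d \<le> e" for d
    using less.prems that by (auto dest: less_le_trans)
  consider "e = \<gamma>" | "\<gamma> < e" "e \<in> acc C" | "\<gamma> < e" "e \<notin> acc C" using less.prems by force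
  then show ?case
  proof cases
    case 1
    then show ?thesis using eq by simp
  next
    case 2
    have "t \<xi> = t' \<xi>" if "\<xi> < e" for \<xi>
    proof -
      have "max \<xi> \<gamma> < e" using 2 that by simp
      then obtain d where d: "d \<in> C" "max \<xi> \<gamma> < d" "d < e" using 2 unfolding acc_iff by blast
      then have "t |` {..<d} = t' |` {..<d}"
        using less.IH[of d] sub[of d] by (simp add: less_imp_le)
      then show ?thesis using d by (metis lessThan_iff max_less_iff_conj restrict_in)
    qed
    then show ?thesis by (auto simp: restrict_map_def)
  next
    case 3
    then obtain d where d: "consecutive C d e" "\<gamma> \<le> d" using consecutive_below C less.prems by metis
    then have "d \<in> C" "d < e" by (auto simp: consecutive_def)
    then have "t |` {..<d} = t' |` {..<d}"
      using less.IH[of d] sub[of d] d by (simp add: less_imp_le)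
    then show ?thesis using coherent_step co d less.prems by metis
  qed
qed

lemma coherent_unique_full:
  assumes "C \<in> CC \<alpha>" "\<alpha> \<in> acc_kappa" "\<gamma> \<in> C"
    and co: "coherent Lev i C \<gamma> t" "coherent Lev i C \<gamma> t'"
    and dom: "dom t = {..<\<alpha>}" "dom t' = {..<\<alpha>}"
    and eq: "t |` {..<\<gamma>} = t' |` {..<\<gamma>}"
  shows "t = t'"
proof
  fix \<xi>
  show "t \<xi> = t' \<xi>"
  proof (cases "\<xi> < \<alpha>")
    case True
    then obtain e where e: "e \<in> C" "\<xi> < e" "\<gamma> < e" "e < \<alpha>"
      using coherent_cofinal_Lev assms by metis
    then have "t |` {..<e} = t' |` {..<e}"
      using coherent_unique[OF CC_closed assms(3) co eq] assms(1) dom by simp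
    then show ?thesis using e by (metis lessThan_iff restrict_in)
  next
    case False
    then show ?thesis using dom by (metis domIff lessThan_iff)
  qed
qed

lemma Lev_small: "|Lev \<alpha>| <o |UNIV :: 'k set|"
proof (induction \<alpha> rule: less_induct)
  case (less \<alpha>)
  show ?case
  proof (cases \<alpha> rule: ordinal_cases)
    case 1
    then show ?thesis by (simp add: Lev_zero small_finite)
  next
    case 2
    let ?R = "\<lambda>C i \<gamma> x. {t. dom t = {..<\<alpha>} \<and> coherent Lev i C \<gamma> t \<and> t |` {..<\<gamma>} = x}"
    \<comment> \<open>A limit node is recovered from its club, bit, start and restriction to the
      start. There are fewer than \<kappa> choices of each, so regularity bounds the level.\<close>
    let ?U = "\<Union>C\<in>CC \<alpha>. \<Union>i\<in>indices \<alpha>. \<Union>\<gamma>\<in>C. \<Union>x\<in>Lev \<gamma>. ?R C i \<gamma> x"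
    have "|?U| <o |UNIV :: 'k set|"
    proof (intro small_UN CC_small)
      show "|indices \<alpha>| <o |UNIV :: 'k set|" by (simp add: indices_def small_finite)
      fix C i \<gamma> x assume C: "C \<in> CC \<alpha>"
      show "|C| <o |UNIV :: 'k set|" using small_mono[OF CC_subset[OF C] small_lessThan] .
      assume "\<gamma> \<in> C"
      then show "|Lev \<gamma>| <o |UNIV :: 'k set|" using less CC_subset[OF C] by auto
      obtain u where u: "?R C i \<gamma> x \<subseteq> {u}"
        using coherent_unique_full[OF C 2 \<open>\<gamma> \<in> C\<close>] by blast
      show "|?R C i \<gamma> x| <o |UNIV :: 'k set|" by (rule small_mono[OF u small_finite]) simp
    qed
    moreover have "Lev \<alpha> \<subseteq> ?U"
    proof
      fix t assume t: "t \<in> Lev \<alpha>"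
      then obtain C i \<gamma> where C: "C \<in> CC \<alpha>" "i \<in> indices \<alpha>" "\<gamma> \<in> C" "coherent Lev i C \<gamma> t"
        using 2 by (blast elim: Lev_limit_elim)
      moreover have "\<gamma> \<le> \<alpha>" using CC_subset[OF C(1)] C(3) by auto
      then have "t |` {..<\<gamma>} \<in> Lev \<gamma>" by (rule Lev_restrict[OF t])
      ultimately show "t \<in> ?U" using Lev_dom[OF t] by blast
    qed
    ultimately show ?thesis by (rule small_mono[rotated])
  next
    case (3 \<beta>)
    have "Lev \<alpha> = (\<Union>t\<in>Lev \<beta>. (\<lambda>i. t(\<beta> \<mapsto> vN i)) ` {..<max omega \<beta>})"
      using 3 by (auto simp: Lev_succ)
    then show ?thesis using less[OF 3(2)] by (simp add: small_UN small_image small_lessThan)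
  qed
qed

section \<open>Extending nodes along a club, and normality\<close>

lemma step_spec:
  assumes "s \<in> Lev e" "t(d \<mapsto> vN i) \<subseteq>\<^sub>m s"
  shows "step Lev i t d e \<in> Lev e" "t(d \<mapsto> vN i) \<subseteq>\<^sub>m step Lev i t d e"
proof -
  have "step Lev i t d e \<in> Lev e \<and> t(d \<mapsto> vN i) \<subseteq>\<^sub>m step Lev i t d e"
  proof (cases "\<exists>s. s \<in> Lev e \<and> t(d \<mapsto> vN i) \<subseteq>\<^sub>m s \<and> meets Lev e s")
    case True
    from someI_ex[OF True] show ?thesis unfolding step_def if_P[OF True] by blast
  next
    case False
    have "\<exists>s. s \<in> Lev e \<and> t(d \<mapsto> vN i) \<subseteq>\<^sub>m s" using assms by blast
    from someI_ex[OF this] show ?thesis unfolding step_def if_not_P[OF False] .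
  qed
  then show "step Lev i t d e \<in> Lev e" "t(d \<mapsto> vN i) \<subseteq>\<^sub>m step Lev i t d e" by auto
qed

lemma step_meets:
  assumes "s \<in> Lev e" "t(d \<mapsto> vN i) \<subseteq>\<^sub>m s" "meets Lev e s"
  shows "meets Lev e (step Lev i t d e)"
proof -
  have ex: "\<exists>s. s \<in> Lev e \<and> t(d \<mapsto> vN i) \<subseteq>\<^sub>m s \<and> meets Lev e s" using assms by blast
  from someI_ex[OF this] show ?thesis unfolding step_def if_P[OF ex] by blast
qed

text \<open>By determinacy the chosen partial branches extend one another, so they can be glued. The
  bound \<delta> is kept general to cover limit points of \<open>C\<close> as well as \<alpha>
  itself.\<close>

lemma coherent_union:
  assumes C: "closed_subset_of C \<alpha>" "\<gamma> \<in> C" "\<gamma> < \<delta>" "\<And>\<beta>. \<beta> < \<delta> \<Longrightarrow> \<exists>c\<in>C. \<beta> < c \<and> c < \<delta>"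
    and ex: "\<And>e. e \<in> C \<Longrightarrow> \<gamma> \<le> e \<Longrightarrow> e < \<delta> \<Longrightarrow>
      \<exists>t. t \<in> Lev e \<and> x \<subseteq>\<^sub>m t \<and> coherent Lev i C \<gamma> t"
    and x: "x \<in> Lev \<gamma>"
  shows "\<exists>t. dom t = {..<\<delta>} \<and> x \<subseteq>\<^sub>m t \<and> coherent Lev i (C \<inter> {..<\<delta>}) \<gamma> t"
proof -
  obtain f where f: "\<And>e. e \<in> C \<Longrightarrow> \<gamma> \<le> e \<Longrightarrow> e < \<delta> \<Longrightarrow>
      f e \<in> Lev e \<and> x \<subseteq>\<^sub>m f e \<and> coherent Lev i C \<gamma> (f e)" using ex by metis
  have restr: "f e |` {..<d} = f d" if "d \<in> C" "e \<in> C" "\<gamma> \<le> d" "d \<le> e" "e < \<delta>" for d e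
  proof -
    have fe: "f e \<in> Lev e \<and> x \<subseteq>\<^sub>m f e \<and> coherent Lev i C \<gamma> (f e)" using f that by auto
    have fd: "f d \<in> Lev d \<and> x \<subseteq>\<^sub>m f d \<and> coherent Lev i C \<gamma> (f d)" using f that by auto
    have "f e |` {..<\<gamma>} = f d |` {..<\<gamma>}"
      using fe fd map_le_restrict_eq Lev_dom[OF x] by metis
    then have "f e |` {..<d} = f d |` {..<d}"
      using fe fd that coherent_unique[OF C(1,2)] Lev_dom by (metis lessThan_subset_iff order_refl)
    then show ?thesis using fd Lev_dom restrict_dom by metis
  qed
  \<comment> \<open>An element of \<open>C\<close> above \<xi> at which the value at \<xi> is read
    off; \<open>val\<close> shows that any other such element gives the same value.\<close>
  define n where "n \<xi> = (SOME c. c \<in> C \<and> \<gamma> \<le> c \<and> \<xi> < c \<and> c < \<delta>)" for \<xi>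
  have n: "n \<xi> \<in> C \<and> \<gamma> \<le> n \<xi> \<and> \<xi> < n \<xi> \<and> n \<xi> < \<delta>" if "\<xi> < \<delta>" for \<xi>
  proof -
    have "max \<xi> \<gamma> < \<delta>" using that C(3) by simp
    then obtain c where "c \<in> C" "max \<xi> \<gamma> < c" "c < \<delta>" using C(4) by blast
    then have "\<exists>c. c \<in> C \<and> \<gamma> \<le> c \<and> \<xi> < c \<and> c < \<delta>" by auto
    then show ?thesis unfolding n_def by (rule someI_ex)
  qed
  define t where "t \<xi> = (if \<xi> < \<delta> then f (n \<xi>) \<xi> else None)" for \<xi>
  have val: "t \<xi> = f e \<xi>" if "e \<in> C" "\<gamma> \<le> e" "\<xi> < e" "e < \<delta>" for \<xi> e
  proof -
    have \<xi>: "\<xi> < \<delta>" using that by simp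
    have "f e \<xi> = f (n \<xi>) \<xi>"
    proof (cases "e \<le> n \<xi>")
      case True
      then show ?thesis using restr[of e "n \<xi>"] n[OF \<xi>] that by (metis lessThan_iff restrict_in)
    next
      case False
      then show ?thesis using restr[of "n \<xi>" e] n[OF \<xi>] that
        by (metis lessThan_iff restrict_in less_imp_le not_le)
    qed
    then show ?thesis using \<xi> by (simp add: t_def)
  qed
  have te: "t |` {..<e} = f e" if "e \<in> C" "\<gamma> \<le> e" "e < \<delta>" for e
  proof
    fix \<xi>
    have "\<xi> \<notin> dom (f e)" if "\<not> \<xi> < e" using that f Lev_dom \<open>e \<in> C\<close> \<open>\<gamma> \<le> e\<close> \<open>e < \<delta>\<close> by fastforce
    then show "(t |` {..<e}) \<xi> = f e \<xi>" using val[of e \<xi>] that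
      by (cases "\<xi> < e") (auto simp: domIff)
  qed
  have dt: "dom t = {..<\<delta>}"
  proof -
    have "t \<xi> \<noteq> None" if "\<xi> < \<delta>" for \<xi>
      using n[OF that] f[of "n \<xi>"] Lev_dom[of "f (n \<xi>)" "n \<xi>"] that by (auto simp: t_def)
    then show ?thesis by (auto simp: t_def split: if_splits)
  qed
  have "x \<subseteq>\<^sub>m t"
    using te[of \<gamma>] f[of \<gamma>] C restrict_map_le[of t "{..<\<gamma>}"] map_le_trans by (metis order_refl)
  moreover have "coherent Lev i (C \<inter> {..<\<delta>}) \<gamma> t"
    unfolding coherent_def
  proof (intro ballI impI conjI allI)
    fix e assume e: "e \<in> C \<inter> {..<\<delta>}" "\<gamma> \<le> e \<and> {..<e} \<subseteq> dom t"
    then show "t |` {..<e} \<in> Lev e" using te f by auto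
    fix d assume d: "consecutive (C \<inter> {..<\<delta>}) d e \<and> \<gamma> \<le> d"
    then have c: "consecutive C d e" using e by (auto simp: consecutive_def)
    then have "d \<in> C" "d \<le> e" "d < \<delta>" using e by (auto simp: consecutive_def)
    have "f e |` {..<e} = step Lev i (f e |` {..<d}) d e"
      using coherent_step[of i C \<gamma> "f e" d e] f[of e] e d c Lev_dom[of "f e" e] by auto
    moreover have "f e |` {..<e} = f e" using restr[of e e] e by simp
    ultimately show "t |` {..<e} = step Lev i (t |` {..<d}) d e"
      using restr[of d e] te[of d] te[of e] e d \<open>d \<in> C\<close> \<open>d \<le> e\<close> \<open>d < \<delta>\<close> by simp
  qed
  ultimately show ?thesis using dt by blast
qed

text \<open>Induction along \<open>C\<close>, gluing at limit points and applying
  \<open>step\<close> elsewhere. Normality below \<alpha> is an assumption because the lemma is used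
  inside the inductive proof of \<open>Lev_normal\<close>.\<close>

lemma coherent_extension_below:
  assumes C: "C \<in> CC \<alpha>" and \<gamma>: "\<gamma> \<in> C" and x: "x \<in> Lev \<gamma>" and i: "i \<in> {ozero, osucc ozero}"
    and normal: "\<And>\<beta> \<delta> t. \<beta> \<le> \<delta> \<Longrightarrow> \<delta> < \<alpha> \<Longrightarrow> t \<in> Lev \<beta> \<Longrightarrow> \<exists>s\<in>Lev \<delta>. t \<subseteq>\<^sub>m s"
  shows "e \<in> C \<Longrightarrow> \<gamma> \<le> e \<Longrightarrow> \<exists>t. t \<in> Lev e \<and> x \<subseteq>\<^sub>m t \<and> coherent Lev i C \<gamma> t"
proof (induction e rule: less_induct)
  case (less e)
  have cl: "closed_subset_of C \<alpha>" using CC_closed[OF C] .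
  have "e < \<alpha>" using less.prems CC_subset[OF C] by auto
  consider "e = \<gamma>" | "\<gamma> < e" "e \<in> acc C" | "\<gamma> < e" "e \<notin> acc C" using less.prems by force
  then show ?case
  proof cases
    case 1
    have "coherent Lev i C \<gamma> x"
      using x Lev_dom[OF x] restrict_dom[OF Lev_dom[OF x]]
      by (auto simp: coherent_def consecutive_def)
    then show ?thesis using x 1 by auto
  next
    case 2
    then have un: "\<And>\<beta>. \<beta> < e \<Longrightarrow> \<exists>c\<in>C. \<beta> < c \<and> c < e" by (auto simp: acc_iff)
    obtain t where t: "dom t = {..<e}" "x \<subseteq>\<^sub>m t" "coherent Lev i (C \<inter> {..<e}) \<gamma> t"
      using coherent_union[OF cl \<gamma> 2(1) un less.IH x] by auto
    have "e \<in> acc_kappa" using 2 by (auto simp: acc_iff acc_kappa_iff)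
    moreover have "C \<inter> {..<e} \<in> CC e" "e \<notin> S" using CC_coherent[OF C 2(2)] by auto
    ultimately have "t \<in> Lev e"
      using t i \<gamma> 2 by (auto simp: Lev_limit limit_level_def indices_def)
    moreover have "coherent Lev i C \<gamma> t"
      unfolding coherent_def
    proof (intro ballI impI conjI allI)
      fix e' assume e': "e' \<in> C" "\<gamma> \<le> e' \<and> {..<e'} \<subseteq> dom t"
      then have "e' \<le> e" using t by simp
      then show "t |` {..<e'} \<in> Lev e'" using Lev_restrict \<open>t \<in> Lev e\<close> by simp
      fix d assume d: "consecutive C d e' \<and> \<gamma> \<le> d"
      \<comment> \<open>A limit point of \<open>C\<close> has no immediate predecessor in
        \<open>C\<close>, so no new step condition arises at \<open>e\<close>.\<close>
      have "e' \<noteq> e" using un d by (auto simp: consecutive_def)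
      then have "consecutive (C \<inter> {..<e}) d e'" using d \<open>e' \<le> e\<close> by (auto simp: consecutive_def)
      then show "t |` {..<e'} = step Lev i (t |` {..<d}) d e'"
        using coherent_step[OF t(3)] d e' by blast
    qed
    ultimately show ?thesis using t by blast
  next
    case 3
    then obtain d where d: "consecutive C d e" "\<gamma> \<le> d"
      using consecutive_below[OF cl \<gamma> less.prems(1)] by metis
    then have "d \<in> C" "d < e" by (auto simp: consecutive_def)
    then obtain u where u: "u \<in> Lev d" "x \<subseteq>\<^sub>m u" "coherent Lev i C \<gamma> u" using less.IH d by blast
    \<comment> \<open>Normality from level \<open>osucc d\<close> to level \<open>e\<close>
      guarantees that \<open>step\<close> chooses from a nonempty set.\<close>
    have "osucc d \<le> e" using \<open>d < e\<close> by (rule osucc_le)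
    then obtain s where s: "s \<in> Lev e" "u(d \<mapsto> vN i) \<subseteq>\<^sub>m s"
      using normal[OF _ \<open>e < \<alpha>\<close> Lev_succI[OF u(1) i]] by blast
    define t where "t = step Lev i u d e"
    have t: "t \<in> Lev e" "u(d \<mapsto> vN i) \<subseteq>\<^sub>m t" using step_spec[OF s] by (auto simp: t_def)
    have dom: "dom u = {..<d}" "dom t = {..<e}" using u t Lev_dom by auto
    have "u \<subseteq>\<^sub>m u(d \<mapsto> vN i)" using dom by (auto simp: map_le_def)
    then have ut: "u \<subseteq>\<^sub>m t" using t map_le_trans by blast
    then have td: "t |` {..<d} = u" using dom map_le_restrict_eq by blast
    have "coherent Lev i C \<gamma> t"
      unfolding coherent_def
    proof (intro ballI impI conjI allI)
      fix e' assume e': "e' \<in> C" "\<gamma> \<le> e' \<and> {..<e'} \<subseteq> dom t"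
      then have "e' \<le> e" using dom by simp
      then show "t |` {..<e'} \<in> Lev e'" using Lev_restrict t by simp
      fix d' assume d': "consecutive C d' e' \<and> \<gamma> \<le> d'"
      show "t |` {..<e'} = step Lev i (t |` {..<d'}) d' e'"
      proof (cases "e' = e")
        case True
        then have "d' = d" using d d' by (fastforce simp: consecutive_def)
        then show ?thesis using True td restrict_dom[OF dom(2)] by (simp add: t_def)
      next
        case False
        then have le: "e' \<le> d" using d e' \<open>e' \<le> e\<close> by (force simp: consecutive_def)
        have "d' \<le> d" using le d' by (auto simp: consecutive_def)
        have "u |` {..<e'} = step Lev i (u |` {..<d'}) d' e'"
          using coherent_step[OF u(3)] d' dom le by simp
        then show ?thesis
          using le \<open>d' \<le> d\<close> restrict_le_restrict[of _ d t] by (simp flip: td)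
      qed
    qed
    then show ?thesis using t ut u map_le_trans by blast
  qed
qed

text \<open>The result is deliberately not claimed to be a node: for \<alpha> in \<open>S\<close>
  and bit \<open>1\<close> it yields the branch that will vanish.\<close>

lemma coherent_extension:
  assumes C: "C \<in> CC \<alpha>" and \<gamma>: "\<gamma> \<in> C" and \<alpha>: "\<alpha> \<in> acc_kappa"
    and x: "x \<in> Lev \<gamma>" and i: "i \<in> {ozero, osucc ozero}"
    and normal: "\<And>\<beta> \<delta> t. \<beta> \<le> \<delta> \<Longrightarrow> \<delta> < \<alpha> \<Longrightarrow> t \<in> Lev \<beta> \<Longrightarrow> \<exists>s\<in>Lev \<delta>. t \<subseteq>\<^sub>m s"
  obtains t where "dom t = {..<\<alpha>}" "x \<subseteq>\<^sub>m t" "coherent Lev i C \<gamma> t"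
proof -
  have sub: "C \<subseteq> {..<\<alpha>}" using CC_subset[OF C] .
  have un: "\<And>\<beta>. \<beta> < \<alpha> \<Longrightarrow> \<exists>c\<in>C. \<beta> < c \<and> c < \<alpha>" using CC_unbounded[OF C \<alpha>] sub by blast
  have "\<gamma> < \<alpha>" using \<gamma> sub by auto
  have ex: "\<exists>t. t \<in> Lev e \<and> x \<subseteq>\<^sub>m t \<and> coherent Lev i C \<gamma> t" if "e \<in> C" "\<gamma> \<le> e" for e
    by (rule coherent_extension_below[OF C \<gamma> x i]) (use normal that in auto)
  obtain t where "dom t = {..<\<alpha>}" "x \<subseteq>\<^sub>m t" "coherent Lev i (C \<inter> {..<\<alpha>}) \<gamma> t"
    using coherent_union[OF CC_closed[OF C] \<gamma> \<open>\<gamma> < \<alpha>\<close> un ex x] by auto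
  moreover have "C \<inter> {..<\<alpha>} = C" using sub by auto
  ultimately show thesis using that by simp
qed

lemma Lev_normal: "\<beta> \<le> \<alpha> \<Longrightarrow> t \<in> Lev \<beta> \<Longrightarrow> \<exists>s\<in>Lev \<alpha>. t \<subseteq>\<^sub>m s"
proof (induction \<alpha> arbitrary: \<beta> t rule: less_induct)
  case (less \<alpha>)
  show ?case
  proof (cases "\<beta> = \<alpha>")
    case True
    then show ?thesis using less.prems map_le_refl by blast
  next
    case False
    then have "\<beta> < \<alpha>" using less by simp
    show ?thesis
    proof (cases \<alpha> rule: ordinal_cases)
      case 1
      then show ?thesis using \<open>\<beta> < \<alpha>\<close> ozero_le[of \<beta>] by (simp add: not_le[symmetric])
    next
      case 2
      obtain C where C: "C \<in> CC \<alpha>" using CC_nonempty by blast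
      obtain \<gamma> where \<gamma>: "\<gamma> \<in> C" "\<beta> < \<gamma>" using CC_unbounded[OF C 2 \<open>\<beta> < \<alpha>\<close>] by blast
      then have "\<gamma> < \<alpha>" using CC_subset[OF C] by auto
      then obtain x where x: "x \<in> Lev \<gamma>" "t \<subseteq>\<^sub>m x" using less.IH[of \<gamma> \<beta> t] \<gamma> less.prems less_imp_le by blast
      obtain s where s: "dom s = {..<\<alpha>}" "x \<subseteq>\<^sub>m s" "coherent Lev ozero C \<gamma> s"
        using coherent_extension[OF C \<gamma>(1) 2 x(1), of ozero] less.IH by blast
      moreover have "ozero \<in> indices \<alpha>" by (simp add: indices_def)
      ultimately have "s \<in> Lev \<alpha>" using C \<gamma> 2 by (auto simp: Lev_limit limit_level_def)
      then show ?thesis using s x map_le_trans by blast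
    next
      case (3 \<delta>)
      then have "\<beta> \<le> \<delta>" using \<open>\<beta> < \<alpha>\<close> by (simp add: less_osucc_iff)
      then obtain s where s: "s \<in> Lev \<delta>" "t \<subseteq>\<^sub>m s" using less 3 by blast
      have "s(\<delta> \<mapsto> vN ozero) \<in> Lev \<alpha>" using Lev_succI[OF s(1)] 3 by simp
      moreover have "s \<subseteq>\<^sub>m s(\<delta> \<mapsto> vN ozero)" using Lev_dom[OF s(1)] by (auto simp: map_le_def)
      ultimately show ?thesis using s map_le_trans by blast
    qed
  qed
qed

lemma Lev_nonempty: "Lev \<alpha> \<noteq> {}"
  using Lev_normal[of ozero \<alpha> Map.empty] by (auto simp: Lev_zero)

lemma step_extends:
  assumes "t \<in> Lev d" "d < e" "i \<in> {ozero, osucc ozero}"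
  shows "t(d \<mapsto> vN i) \<subseteq>\<^sub>m step Lev i t d e"
  using Lev_normal[OF osucc_le[OF assms(2)] Lev_succI[OF assms(1,3)]] step_spec(2) by blast

text \<open>Injectivity of \<open>p\<close> recovers the level; the injection chosen there, which
  exists because the level is small, recovers the node.\<close>

lemma code_inject:
  assumes "code Lev \<gamma> s = code Lev \<delta> t" "s \<in> Lev \<gamma>" "t \<in> Lev \<delta>"
  shows "s = t"
proof -
  have "\<exists>g :: 'k node \<Rightarrow> 'k. inj_on g (Lev \<gamma>)"
    using ordLess_imp_ordLeq[OF Lev_small[of \<gamma>]] by (auto simp: card_of_ordLeq[symmetric])
  then have "inj_on (SOME g :: 'k node \<Rightarrow> 'k. inj_on g (Lev \<gamma>)) (Lev \<gamma>)" by (rule someI_ex)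
  moreover have "\<gamma> = \<delta>" using injD[OF inj_p assms(1)[unfolded code_def]] by simp
  ultimately show ?thesis
    using assms(2,3) injD[OF inj_p assms(1)[unfolded code_def]] by (auto dest: inj_onD)
qed

section \<open>The Souslin property and the vanishing levels\<close>

text \<open>The guessing sequence makes some limit level lie entirely above a given dense set: at
  \<open>e \<in> B\<close> the guess \<open>A e\<close> codes the part of \<open>Y\<close> below \<open>e\<close>, so that \<open>step\<close> enters \<open>Y\<close>, and
  every node of the level \<open>\<alpha>\<close> takes such a step.\<close>

lemma dense_level:
  assumes dense: "\<And>\<alpha> t. t \<in> Lev \<alpha> \<Longrightarrow> \<exists>\<beta>. \<exists>y\<in>Lev \<beta> \<inter> Y. t \<subseteq>\<^sub>m y"
  obtains \<alpha> where "\<And>t. t \<in> Lev \<alpha> \<Longrightarrow> \<exists>y\<in>Y. y \<subseteq>\<^sub>m t"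
proof -
  define X where "X = {code Lev \<gamma> y |\<gamma> y. y \<in> Lev \<gamma> \<inter> Y}"
  define h where "h t = (SOME \<beta>. \<exists>y\<in>Lev \<beta> \<inter> Y. t \<subseteq>\<^sub>m y)" for t
  have h: "\<exists>y\<in>Lev (h t) \<inter> Y. t \<subseteq>\<^sub>m y" if "t \<in> Lev \<alpha>" for \<alpha> t
    unfolding h_def using dense[OF that] by (rule someI_ex)
  \<comment> \<open>Closure points \<open>e\<close> of the resulting \<open>f\<close> reflect
    density: a node below level \<open>e\<close> has an extension in \<open>Y\<close> whose level
    and code are both below \<open>e\<close>.\<close>
  have "\<exists>b. osucc \<gamma> < b \<and> (\<forall>t\<in>Lev \<gamma>. code Lev \<gamma> t < b \<and> h t < b)" for \<gamma>
  proof -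
    let ?Z = "\<Union>t\<in>Lev \<gamma>. {code Lev \<gamma> t, h t, osucc \<gamma>}"
    have "|?Z| <o |UNIV :: 'k set|" by (intro small_UN Lev_small small_finite) simp
    then obtain b where "\<forall>z\<in>?Z. z < b" using small_bounded by blast
    then show ?thesis using Lev_nonempty[of \<gamma>] by auto
  qed
  then obtain f where f: "\<And>\<gamma>. osucc \<gamma> < f \<gamma>" "\<And>\<gamma> t. t \<in> Lev \<gamma> \<Longrightarrow> code Lev \<gamma> t < f \<gamma>"
    "\<And>\<gamma> t. t \<in> Lev \<gamma> \<Longrightarrow> h t < f \<gamma>" by metis
  define B where "B = {\<beta>. ozero < \<beta> \<and> (\<forall>\<gamma><\<beta>. f \<gamma> < \<beta>) \<and> X \<inter> {..<\<beta>} = A \<beta>}"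
  have enter: "\<exists>y\<in>Y. y \<subseteq>\<^sub>m step Lev i t d e"
    if e: "e \<in> B" "d < e" and t: "t \<in> Lev d" and i: "i \<in> {ozero, osucc ozero}" for d e t i
  proof -
    have fe: "f \<gamma> < e" if "\<gamma> < e" for \<gamma> using e that by (simp add: B_def)
    have A: "X \<inter> {..<e} = A e" using e by (simp add: B_def)
    have sd: "osucc d < e" using f(1)[of d] fe[OF e(2)] by (rule less_trans)
    have t': "t(d \<mapsto> vN i) \<in> Lev (osucc d)" using Lev_succI[OF t i] .
    let ?\<delta> = "h (t(d \<mapsto> vN i))"
    obtain y where y: "y \<in> Lev ?\<delta>" "y \<in> Y" "t(d \<mapsto> vN i) \<subseteq>\<^sub>m y" using h[OF t'] by blast
    have \<delta>: "?\<delta> < e" using f(3)[OF t'] fe[OF sd] by (rule less_trans)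
    \<comment> \<open>Extending \<open>y\<close> to level \<open>e\<close> gives a candidate that
      meets the guess, so the first case of \<open>step\<close> applies.\<close>
    obtain s where s: "s \<in> Lev e" "y \<subseteq>\<^sub>m s" using Lev_normal[OF less_imp_le[OF \<delta>] y(1)] by blast
    have "code Lev ?\<delta> y \<in> A e"
      using A y less_trans[OF f(2)[OF y(1)] fe[OF \<delta>]] by (auto simp: X_def)
    then have "meets Lev e s"
      using \<delta> map_le_restrict_eq[OF s(2) Lev_dom[OF y(1)]] by (auto simp: meets_def)
    moreover have ts: "t(d \<mapsto> vN i) \<subseteq>\<^sub>m s" using y s map_le_trans by blast
    ultimately have "meets Lev e (step Lev i t d e)" using step_meets s by blast
    \<comment> \<open>The node that \<open>step\<close> selects may meet the guess through another
      member of \<open>Y\<close> than \<open>y\<close>; decoding the guess still lands in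
      \<open>Y\<close>.\<close>
    then obtain \<gamma> where \<gamma>: "\<gamma> < e" "code Lev \<gamma> (step Lev i t d e |` {..<\<gamma>}) \<in> A e"
      by (auto simp: meets_def)
    then obtain \<eta> z where z: "code Lev \<gamma> (step Lev i t d e |` {..<\<gamma>}) = code Lev \<eta> z"
      "z \<in> Lev \<eta>" "z \<in> Y" using A unfolding X_def by blast
    have "step Lev i t d e |` {..<\<gamma>} \<in> Lev \<gamma>"
      using Lev_restrict[OF step_spec(1)[OF s(1) ts]] \<gamma> by simp
    then have "step Lev i t d e |` {..<\<gamma>} = z" using code_inject z by blast
    then show ?thesis using z restrict_map_le by metis
  qed
  have "cofinal_kappa B"
    unfolding cofinal_kappa_def
  proof
    fix \<alpha>
    obtain \<beta> where "\<beta> \<in> {\<beta>. X \<inter> {..<\<beta>} = A \<beta>}" "ozero < \<beta>" "\<And>\<gamma>. \<gamma> < \<beta> \<Longrightarrow> max \<alpha> (f \<gamma>) < \<beta>"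
      using stationary_closure_point[OF guess[of X], of "\<lambda>\<gamma>. max \<alpha> (f \<gamma>)"] by blast
    then show "\<exists>\<beta>\<in>B. \<alpha> \<le> \<beta>" by (intro bexI[of _ \<beta>]) (auto simp: B_def intro: less_imp_le)
  qed
  then obtain \<alpha> where \<alpha>: "\<forall>C\<in>CC \<alpha>. osup (nacc C \<inter> B) = \<alpha>" "ozero < \<alpha>" "\<And>\<gamma>. \<gamma> < \<alpha> \<Longrightarrow> osucc \<gamma> < \<alpha>"
    using stationary_closure_point[OF CC_hits, of B osucc] by blast
  have lim: "\<alpha> \<in> acc_kappa" using closure_point_limit \<alpha> by blast
  show thesis
  proof
    fix t assume t: "t \<in> Lev \<alpha>"
    then obtain C i \<gamma> where C: "C \<in> CC \<alpha>" "i \<in> indices \<alpha>" "\<gamma> \<in> C" "coherent Lev i C \<gamma> t"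
      using lim by (blast elim: Lev_limit_elim)
    have "nacc C \<inter> B \<subseteq> {..<\<alpha>}" using CC_subset[OF C(1)] by (auto simp: nacc_def)
    moreover have "\<gamma> < \<alpha>" using C CC_subset by auto
    \<comment> \<open>The point \<open>e\<close> must be in \<open>B\<close> for the guess to be
      correct, outside \<open>acc C\<close> to have a predecessor, and above \<gamma> for the branch
      to have taken a step up to it.\<close>
    ultimately obtain e where e: "e \<in> nacc C" "e \<in> B" "\<gamma> < e" "e < \<alpha>"
      using osup_eq_iff[of "nacc C \<inter> B" \<alpha>] \<alpha>(1) C(1) by blast
    then obtain d where d: "consecutive C d e" "\<gamma> \<le> d"
      using consecutive_below[OF CC_closed[OF C(1)] C(3), of e] by (auto simp: nacc_def)
    then have "d < e" by (simp add: consecutive_def)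
    have "t |` {..<e} = step Lev i (t |` {..<d}) d e"
      using coherent_step[OF C(4) d] Lev_dom[OF t] e by simp
    moreover have "t |` {..<d} \<in> Lev d" using Lev_restrict[OF t] \<open>d < e\<close> e by simp
    moreover have "i \<in> {ozero, osucc ozero}" using C(2) by (auto simp: indices_def split: if_splits)
    ultimately obtain y where "y \<in> Y" "y \<subseteq>\<^sub>m t |` {..<e}" using enter e \<open>d < e\<close> by metis
    then show "\<exists>y\<in>Y. y \<subseteq>\<^sub>m t" using restrict_map_le map_le_trans by blast
  qed
qed

section \<open>The tree as the union of its levels\<close>

definition T :: "'k node set" where
  "T = (\<Union>\<alpha>. Lev \<alpha>)"

lemma T_seqs: "T \<subseteq> (\<Union>\<alpha>. seqs \<alpha>)"
  using Lev_seqs by (auto simp: T_def)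

lemma T_restrict: "\<forall>t\<in>T. \<forall>\<beta>. t |` {..<\<beta>} \<in> T"
proof (intro ballI allI)
  fix t \<beta> assume "t \<in> T"
  then obtain \<alpha> where t: "t \<in> Lev \<alpha>" by (auto simp: T_def)
  show "t |` {..<\<beta>} \<in> T"
  proof (cases "\<beta> \<le> \<alpha>")
    case True
    then show ?thesis using Lev_restrict[OF t] by (auto simp: T_def)
  next
    case False
    then have "dom t \<subseteq> {..<\<beta>}" using Lev_dom[OF t] by simp
    then have "t |` {..<\<beta>} = t" by (intro ext) (metis domIff restrict_map_def subsetD)
    then show ?thesis using \<open>t \<in> T\<close> by simp
  qed
qed

lemma T_level: "level T \<alpha> = Lev \<alpha>"
proof
  show "Lev \<alpha> \<subseteq> level T \<alpha>" using Lev_seqs by (auto simp: level_def T_def)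
  show "level T \<alpha> \<subseteq> Lev \<alpha>"
  proof
    fix t assume "t \<in> level T \<alpha>"
    then obtain \<beta> where "t \<in> Lev \<beta>" "dom t = {..<\<alpha>}" by (auto simp: level_def T_def seqs_def)
    then show "t \<in> Lev \<alpha>" using Lev_dom by (metis lessThan_eq_iff)
  qed
qed

lemma T_ht: "t \<in> Lev \<alpha> \<Longrightarrow> ht T t = \<alpha>"
  by (rule ht_eq[OF T_restrict T_seqs]) (auto simp: T_def Lev_dom)

lemma T_ht_Lev: "t \<in> T \<Longrightarrow> t \<in> Lev (ht T t)"
  using T_ht by (auto simp: T_def)

lemma T_streamlined: "streamlined_tree T"
  using T_seqs T_restrict by (simp add: streamlined_tree_def T_level Lev_nonempty Lev_small)

lemma T_normal: "normal_tree T"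
  unfolding normal_tree_def T_level using Lev_normal less_imp_le by blast

lemma T_prolific: "prolific T"
  unfolding prolific_def T_level
proof (intro allI ballI impI)
  fix \<alpha> t i assume "t \<in> Lev \<alpha>" "i < max omega \<alpha>"
  then have "t(\<alpha> \<mapsto> vN i) \<in> Lev (osucc \<alpha>)" unfolding Lev_succ by blast
  then show "t(\<alpha> \<mapsto> vN i) \<in> T" by (auto simp: T_def)
qed

text \<open>The two one-bit extensions of a node cannot both lie below members of a chain, so the
  nodes leaving \<open>B\<close> are dense. Some level is then entirely above such nodes, yet
  \<open>B\<close> has a member on it.\<close>

lemma T_no_branch: "\<not> branch T UNIV B"
proof
  assume B: "branch T UNIV B"
  define Y where "Y = {t. \<forall>b\<in>B. \<not> t \<subseteq>\<^sub>m b}"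
  have "\<exists>\<beta>. \<exists>y\<in>Lev \<beta> \<inter> Y. t \<subseteq>\<^sub>m y" if t: "t \<in> Lev \<alpha>" for \<alpha> t
  proof (rule ccontr)
    assume no: "\<not> ?thesis"
    have "\<exists>b\<in>B. t(\<alpha> \<mapsto> vN i) \<subseteq>\<^sub>m b" if i: "i \<in> {ozero, osucc ozero}" for i
    proof -
      have "t \<subseteq>\<^sub>m t(\<alpha> \<mapsto> vN i)" using Lev_dom[OF t] by (auto simp: map_le_def)
      then show ?thesis using no Lev_succI[OF t i] by (auto simp: Y_def)
    qed
    then obtain b b' where b: "b \<in> B" "t(\<alpha> \<mapsto> vN ozero) \<subseteq>\<^sub>m b"
      "b' \<in> B" "t(\<alpha> \<mapsto> vN (osucc ozero)) \<subseteq>\<^sub>m b'" by blast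
    then have "b \<alpha> = Some (vN ozero)" "b' \<alpha> = Some (vN (osucc ozero))"
      by (auto simp: map_le_def)
    moreover have "b \<subseteq>\<^sub>m b' \<or> b' \<subseteq>\<^sub>m b" using B b by (auto simp: branch_def)
    ultimately have "vN ozero = vN (osucc ozero :: 'k)" by (force simp: map_le_def)
    then show False using inj_vN osucc_not_limit(2)[of ozero] by (metis injD)
  qed
  then obtain \<alpha> where \<alpha>: "\<And>t. t \<in> Lev \<alpha> \<Longrightarrow> \<exists>y\<in>Y. y \<subseteq>\<^sub>m t" using dense_level by metis
  obtain b where "b \<in> B" "ht T b = \<alpha>" using B by (auto simp: branch_def) (metis UNIV_I image_iff)
  moreover have "b \<in> T" using B \<open>b \<in> B\<close> by (auto simp: branch_def)
  ultimately show False using \<alpha>[of b] T_ht_Lev[of b] by (auto simp: Y_def)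
qed

text \<open>The nodes that lie above \<open>X\<close>, or have no extension in \<open>X\<close>, are
  dense. At a level all above them, a member of \<open>X\<close> of greater height would properly
  extend another member of \<open>X\<close>.\<close>

lemma T_antichain_small:
  assumes "antichain T X"
  shows "|X| <o |UNIV :: 'k set|"
proof -
  have XT: "X \<subseteq> T" and anti: "\<And>s t. s \<in> X \<Longrightarrow> t \<in> X \<Longrightarrow> s \<subseteq>\<^sub>m t \<Longrightarrow> s = t"
    using assms by (auto simp: antichain_def)
  define Y where "Y = {t. (\<exists>x\<in>X. x \<subseteq>\<^sub>m t) \<or> (\<forall>x\<in>X. \<not> t \<subseteq>\<^sub>m x)}"
  have "\<exists>\<beta>. \<exists>y\<in>Lev \<beta> \<inter> Y. t \<subseteq>\<^sub>m y" if "t \<in> Lev \<alpha>" for \<alpha> t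
  proof (cases "\<exists>x\<in>X. t \<subseteq>\<^sub>m x")
    case True
    then obtain x where x: "x \<in> X" "t \<subseteq>\<^sub>m x" by blast
    then have "x \<in> Y" using map_le_refl unfolding Y_def by blast
    then show ?thesis using x XT unfolding T_def by blast
  next
    case False
    then have "t \<in> Y" by (auto simp: Y_def)
    then show ?thesis using that map_le_refl by blast
  qed
  then obtain \<alpha> where \<alpha>: "\<And>t. t \<in> Lev \<alpha> \<Longrightarrow> \<exists>y\<in>Y. y \<subseteq>\<^sub>m t" using dense_level by metis
  have "X \<subseteq> (\<Union>\<beta>\<in>{..<osucc \<alpha>}. Lev \<beta>)"
  proof
    fix x assume x: "x \<in> X"
    then obtain \<beta> where \<beta>: "x \<in> Lev \<beta>" using XT by (auto simp: T_def)
    have "\<beta> \<le> \<alpha>"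
    proof (rule ccontr)
      assume "\<not> \<beta> \<le> \<alpha>"
      then have "\<alpha> < \<beta>" by simp
      then have xa: "x |` {..<\<alpha>} \<in> Lev \<alpha>" using Lev_restrict[OF \<beta>] by simp
      then obtain y where y: "y \<in> Y" "y \<subseteq>\<^sub>m x |` {..<\<alpha>}" using \<alpha> by blast
      then have "y \<subseteq>\<^sub>m x" using restrict_map_le map_le_trans by blast
      then obtain z where z: "z \<in> X" "z \<subseteq>\<^sub>m y" using y x by (auto simp: Y_def)
      then have "z = x" using anti x \<open>y \<subseteq>\<^sub>m x\<close> map_le_trans by blast
      then have "x \<subseteq>\<^sub>m x |` {..<\<alpha>}" using y z map_le_trans by blast
      then have "dom x \<subseteq> {..<\<alpha>}" using map_le_implies_dom_le Lev_dom[OF xa] by metis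
      then show False using Lev_dom[OF \<beta>] \<open>\<alpha> < \<beta>\<close> by simp
    qed
    then show "x \<in> (\<Union>\<beta>\<in>{..<osucc \<alpha>}. Lev \<beta>)" using \<beta> by (auto simp: less_osucc_iff)
  qed
  then show ?thesis by (rule small_mono) (intro small_UN small_lessThan Lev_small)
qed

lemma T_souslin: "souslin T"
  using T_no_branch T_antichain_small not_ordLess_ordIso by (auto simp: souslin_def)

text \<open>The branches with index \<open>1\<close> vanish at the levels in \<open>S\<close>: a node above such a branch would be
  coherent with index \<open>0\<close> along the same club.\<close>

lemma T_vanishing: "S \<subseteq> vanishing_levels T"
proof
  fix \<alpha> assume "\<alpha> \<in> S"
  then have lim: "\<alpha> \<in> acc_kappa" using S_limit by blast
  have "\<exists>B. branch T {..<\<alpha>} B \<and> vanishing T B \<and> x \<in> B" if "x \<in> T" "ht T x < \<alpha>" for x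
  proof -
    define \<delta> where "\<delta> = ht T x"
    have x: "x \<in> Lev \<delta>" "\<delta> < \<alpha>" using that T_ht_Lev by (auto simp: \<delta>_def)
    obtain C where C: "C \<in> CC \<alpha>" using CC_nonempty by blast
    then obtain \<gamma> where \<gamma>: "\<gamma> \<in> C" "\<delta> < \<gamma>" using CC_unbounded[OF C lim] x by blast
    obtain x' where x': "x' \<in> Lev \<gamma>" "x \<subseteq>\<^sub>m x'" using Lev_normal[OF less_imp_le[OF \<gamma>(2)] x(1)] by blast
    \<comment> \<open>Bit \<open>1\<close> is not in \<open>indices \<alpha>\<close>, but all proper
      initial segments of this branch are nodes.\<close>
    obtain t where t: "dom t = {..<\<alpha>}" "x' \<subseteq>\<^sub>m t" "coherent Lev (osucc ozero) C \<gamma> t"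
      by (rule coherent_extension[OF C \<gamma>(1) lim x'(1), of "osucc ozero"])
        (use Lev_normal in auto)
    have t_Lev: "t |` {..<\<beta>} \<in> Lev \<beta>" if \<beta>: "\<beta> < \<alpha>" for \<beta>
    proof -
      obtain e where e: "\<beta> < e" "t |` {..<e} \<in> Lev e"
        using coherent_cofinal_Lev[OF t(3) C lim \<gamma>(1) t(1) \<beta>] by metis
      then show ?thesis
        using Lev_restrict[OF e(2), of \<beta>] restrict_le_restrict[of \<beta> e t] by simp
    qed
    define B where "B = (\<lambda>\<beta>. t |` {..<\<beta>}) ` {..<\<alpha>}"
    have "x = t |` {..<\<delta>}"
      using map_le_restrict_eq[OF map_le_trans[OF x'(2) t(2)] Lev_dom[OF x(1)]] by simp
    then have "x \<in> B" using x(2) by (simp add: B_def)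
    moreover have "branch T {..<\<alpha>} B"
      unfolding branch_def
    proof (intro conjI ballI)
      show "B \<subseteq> T" using t_Lev by (auto simp: B_def T_def)
      have "ht T ` B = (\<lambda>\<beta>. \<beta>) ` {..<\<alpha>}"
        unfolding B_def image_image using T_ht t_Lev by (intro image_cong) auto
      then show "ht T ` B = {..<\<alpha>}" by simp
      fix s s' assume "s \<in> B" "s' \<in> B"
      then obtain \<beta> \<beta>' where "s = t |` {..<\<beta>}" "s' = t |` {..<\<beta>'}" by (auto simp: B_def)
      then show "s \<subseteq>\<^sub>m s' \<or> s' \<subseteq>\<^sub>m s"
        by (cases "\<beta> \<le> \<beta>'") (auto simp: map_le_def restrict_map_def split: if_splits)
    qed
    moreover have "vanishing T B"
      unfolding vanishing_def
    proof
      assume "\<exists>u\<in>T. \<forall>s\<in>B. s \<subseteq>\<^sub>m u"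
      then obtain u where u: "u \<in> T" "\<And>\<beta>. \<beta> < \<alpha> \<Longrightarrow> t |` {..<\<beta>} \<subseteq>\<^sub>m u" by (auto simp: B_def)
      have "t \<subseteq>\<^sub>m u"
        unfolding map_le_def
      proof
        fix \<xi> assume "\<xi> \<in> dom t"
        then have "\<xi> < \<alpha>" using t by simp
        then have "osucc \<xi> < \<alpha>" using osucc_less_limit lim by blast
        then have "t |` {..<osucc \<xi>} \<subseteq>\<^sub>m u" using u by blast
        moreover have "\<xi> \<in> dom (t |` {..<osucc \<xi>})" using \<open>\<xi> \<in> dom t\<close> by simp
        ultimately have "(t |` {..<osucc \<xi>}) \<xi> = u \<xi>" by (auto simp: map_le_def)
        then show "t \<xi> = u \<xi>" by simp
      qed
      \<comment> \<open>Restricting the supposed upper bound makes \<open>t\<close> a node of level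
        \<alpha>, so \<open>t\<close> is also coherent with bit \<open>0\<close>.\<close>
      then have ut: "u |` {..<\<alpha>} = t" using t map_le_restrict_eq by blast
      obtain \<eta> where \<eta>: "u \<in> Lev \<eta>" using u by (auto simp: T_def)
      have "{..<\<alpha>} \<subseteq> {..<\<eta>}"
        using map_le_implies_dom_le[OF \<open>t \<subseteq>\<^sub>m u\<close>] t Lev_dom[OF \<eta>] by simp
      then have tL: "t \<in> Lev \<alpha>" using Lev_restrict[OF \<eta>, of \<alpha>] ut by simp
      then obtain D i \<gamma>' where D: "D \<in> CC \<alpha>" "i \<in> indices \<alpha>" "\<gamma>' \<in> D" "coherent Lev i D \<gamma>' t"
        using lim by (blast elim: Lev_limit_elim)
      have "i = ozero" using D \<open>\<alpha> \<in> S\<close> by (simp add: indices_def)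
      have "D = C" using CC_unique \<open>\<alpha> \<in> S\<close> C D by blast
      \<comment> \<open>Beyond both starts the two coherence conditions apply to the same step, and
        they prescribe different bits at \<open>d\<close>.\<close>
      define d where "d = max \<gamma> \<gamma>'"
      have d: "d \<in> C" "\<gamma> \<le> d" "\<gamma>' \<le> d" using \<gamma> D \<open>D = C\<close> by (auto simp: d_def max_def)
      then have "d < \<alpha>" using CC_subset[OF C] by auto
      then obtain c where "c \<in> C" "d < c" using CC_unbounded[OF C lim] by blast
      then obtain e where e: "consecutive C d e" using consecutive_above d by metis
      then have "e < \<alpha>" "d < e" using CC_subset[OF C] by (auto simp: consecutive_def)
      have sub: "{..<e} \<subseteq> dom t" using t \<open>e < \<alpha>\<close> by simp
      have val: "t d = Some (vN j)"
        if co: "coherent Lev j C \<zeta> t" "\<zeta> \<le> d" and j: "j \<in> {ozero, osucc ozero}" for j \<zeta>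
      proof -
        have "(t |` {..<d})(d \<mapsto> vN j) \<subseteq>\<^sub>m t |` {..<e}"
          unfolding coherent_step[OF co(1) e co(2) sub]
          using step_extends[OF t_Lev[OF \<open>d < \<alpha>\<close>] \<open>d < e\<close> j] .
        then have "(t |` {..<e}) d = Some (vN j)" by (auto simp: map_le_def)
        then show ?thesis using \<open>d < e\<close> by simp
      qed
      have "vN ozero = vN (osucc ozero :: 'k)"
        using val[of ozero \<gamma>'] val[of "osucc ozero" \<gamma>] D d t \<open>D = C\<close> \<open>i = ozero\<close> by simp
      then show False using inj_vN osucc_not_limit(2)[of ozero] by (metis injD)
    qed
    ultimately show ?thesis by blast
  qed
  then show "\<alpha> \<in> vanishing_levels T" using lim by (simp add: vanishing_levels_def)
qed

end

section \<open>From the proxy principle to the hypotheses of the construction\<close>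

theorem theorem4p3:
  fixes S :: "'k::wellorder set"
  assumes "regular_uncountable_cardinal (kappa :: 'k rel)"
    and "S \<subseteq> acc_kappa"
    and "proxy S"
  shows "\<exists>T :: 'k node set. streamlined_tree T \<and> normal_tree T \<and> prolific T \<and> souslin T \<and>
           S \<subseteq> vanishing_levels T"
proof -
  interpret regular_kappa "TYPE('k)" by standard (fact assms(1))
  obtain A :: "'k \<Rightarrow> 'k set" where A: "\<And>X. stationary {\<alpha>. X \<inter> {..<\<alpha>} = A \<alpha>}"
    using assms(3) by (auto simp: proxy_def diamond_def)
  obtain \<C> :: "'k \<Rightarrow> 'k set set" where
    \<C>: "\<forall>\<alpha>. \<C> \<alpha> \<noteq> {} \<and> |\<C> \<alpha>| <o |UNIV :: 'k set| \<and>
      (\<forall>C\<in>\<C> \<alpha>. closed_subset_of C \<alpha> \<and> osup C = osup {..<\<alpha>})" and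
    co: "\<forall>\<alpha>. \<forall>C\<in>\<C> \<alpha>. \<forall>\<alpha>'\<in>acc C. \<exists>D\<in>\<C> \<alpha>'. sq_end S D C" and
    hit: "\<forall>B. cofinal_kappa B \<longrightarrow> stationary {\<alpha>. \<forall>C\<in>\<C> \<alpha>. osup (nacc C \<inter> B) = \<alpha>}"
    using assms(3) unfolding proxy_def by (elim conjE exE)
  have ne: "\<C> \<alpha> \<noteq> {}" and sm: "|\<C> \<alpha>| <o |UNIV :: 'k set|" for \<alpha> using \<C> by auto
  have cl: "closed_subset_of C \<alpha>" and su: "osup C = osup {..<\<alpha>}" if "C \<in> \<C> \<alpha>" for C \<alpha>
    using \<C> that by auto
  have lim: "osup C = \<alpha>" if "C \<in> \<C> \<alpha>" "\<alpha> \<in> acc_kappa" for C \<alpha>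
    using su[OF that(1)] that(2) osup_eq_iff[of "{..<\<alpha>}" \<alpha>] by (auto simp: acc_kappa_iff)
  have sub: "C \<subseteq> {..<\<alpha>}" if "C \<in> \<C> \<alpha>" for C \<alpha> using cl[OF that] by (simp add: closed_subset_of_def)
  have co': "C \<inter> {..<\<beta>} \<in> \<C> \<beta> \<and> \<beta> \<notin> S" if C: "C \<in> \<C> \<alpha>" and \<beta>: "\<beta> \<in> acc C" for C \<alpha> \<beta>
  proof -
    have "\<beta> \<in> acc_kappa" using \<beta> by (auto simp: acc_iff acc_kappa_iff)
    obtain D \<eta> where D: "D \<in> \<C> \<beta>" "D = C \<inter> {..<\<eta>}" "osup D \<notin> S"
      using co C \<beta> unfolding sq_end_def by blast
    have "osup D = \<beta>" using lim D \<open>\<beta> \<in> acc_kappa\<close> by blast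
    \<comment> \<open>If \<eta> exceeded \<beta>, then \<beta> itself would lie in \<open>D\<close>,
      a subset of \<beta>. Since \<open>D\<close> has supremum \<beta>, the cut of \<open>C\<close>
      is made exactly at \<beta>, and \<open>\<sqsubseteq>\<^sup>S\<close> says that \<beta> is not
      in \<open>S\<close>.\<close>
    have "\<eta> \<le> \<beta>" using sub[OF D(1)] D(2) \<beta> by (force simp: acc_iff not_less[symmetric])
    moreover have "osup D \<le> \<eta>" using D(2) by (intro osup_le) auto
    ultimately have "\<eta> = \<beta>" using \<open>osup D = \<beta>\<close> by simp
    then show ?thesis using D \<open>osup D = \<beta>\<close> by simp
  qed
  have "|UNIV \<times> UNIV :: ('k \<times> 'k) set| \<le>o |UNIV :: 'k set|"
    using card_of_Times_same_infinite[OF infinite_UNIV] by (rule ordIso_imp_ordLeq)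
  then obtain p :: "'k \<times> 'k \<Rightarrow> 'k" where p: "inj p" by (auto simp: card_of_ordLeq[symmetric])
  \<comment> \<open>No member of \<open>S\<close> is an accumulation point of any of the clubs, so the families at \<open>S\<close> play no
    role in coherence and can be thinned out to singletons.\<close>
  define CC where "CC \<alpha> = (if \<alpha> \<in> S then {SOME C. C \<in> \<C> \<alpha>} else \<C> \<alpha>)" for \<alpha>
  have CC: "CC \<alpha> \<subseteq> \<C> \<alpha>" for \<alpha> by (simp add: CC_def some_in_eq ne)
  interpret tree_construction "TYPE('k)" S A CC p
  proof
    show "S \<subseteq> acc_kappa" by fact
    show "CC \<alpha> \<noteq> {}" for \<alpha> using ne by (simp add: CC_def)
    show "|CC \<alpha>| <o |UNIV :: 'k set|" for \<alpha> using small_mono[OF CC sm] .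
    show "closed_subset_of C \<alpha>" if "C \<in> CC \<alpha>" for C \<alpha> using cl CC that by blast
    show "\<exists>c\<in>C. \<beta> < c" if "C \<in> CC \<alpha>" "\<alpha> \<in> acc_kappa" "\<beta> < \<alpha>" for C \<alpha> \<beta>
    proof -
      have "C \<in> \<C> \<alpha>" using CC that by blast
      then show ?thesis using osup_eq_iff[OF sub] lim that by blast
    qed
    show "C \<inter> {..<\<beta>} \<in> CC \<beta> \<and> \<beta> \<notin> S" if "C \<in> CC \<alpha>" "\<beta> \<in> acc C" for C \<alpha> \<beta>
      using co'[of C \<alpha> \<beta>] CC that by (auto simp: CC_def[of \<beta>])
    show "C = D" if "\<alpha> \<in> S" "C \<in> CC \<alpha>" "D \<in> CC \<alpha>" for C D \<alpha> using that by (simp add: CC_def)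
    show "stationary {\<alpha>. \<forall>C\<in>CC \<alpha>. osup (nacc C \<inter> B) = \<alpha>}" if "cofinal_kappa B" for B
    proof -
      \<comment> \<open>Thinning the families only weakens the requirement on \<alpha>, so the set
        of hit points grows and stays stationary.\<close>
      have "{\<alpha>. \<forall>C\<in>\<C> \<alpha>. osup (nacc C \<inter> B) = \<alpha>} \<subseteq> {\<alpha>. \<forall>C\<in>CC \<alpha>. osup (nacc C \<inter> B) = \<alpha>}"
        using CC by blast
      then show ?thesis using hit that unfolding stationary_def by blast
    qed
    show "stationary {\<alpha>. X \<inter> {..<\<alpha>} = A \<alpha>}" for X by fact
    show "inj p" by fact
  qed
  show ?thesis
    using T_streamlined T_normal T_prolific T_souslin T_vanishing by blast
qed

end
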